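(* Let $A\in\mathbb{R}^{n\times n}$ be skew-symmetric and $B\in\mathbb{R}^{n\times n}$ symmetric positive definite, and assume that the nonzero eigenvalues $\pm\mathrm{i}\sigma_1,\dots,\pm\mathrm{i}\sigma_\ell$ of $(A,B)$ are simple, with $\sigma_1>\dots>\sigma_\ell>0$. Let $m<\ell$ and let the $m$-step GSSLBD process, started with $q_1\in\mathbb{R}^n$, $\|q_1\|_B=1$, not break down; let $(\theta_i,\tilde u_i,\tilde v_i)$, $i=1,\dots,m$, be the resulting generalized Ritz approximations. For $1\le j\le\ell$, let $(\theta_{j'},\tilde u_{j'},\tilde v_{j'})$ be a generalized Ritz approximation to the generalized spectral triplet $(\sigma_j,u_j,v_j)$ of $(A,B)$ with $\theta_{j'}$ closest to $\sigma_j$ among all the Ritz values $\theta_1,\dots,\theta_m$. Denote $\widetilde{\mathcal{X}}_{j'}=\mathrm{span}\{\tilde u_{j'},\tilde v_{j'}\}$ and $\mathcal{X}_j=\mathrm{span}\{u_j,v_j\}$. Assume that the $B$-angles satisfy $$\angle_B(\tilde u_{j'},u_j)\le\frac{\pi}{4}\quad\text{and}\quad\angle_B(\tilde v_{j'},v_j)\le\frac{\pi}{4}.$$ Then $$|\theta_{j'}-\sigma_j|\le\sigma_j\|\sin\angle_B(\widetilde{\mathcal{X}}_{j'},\mathcal{X}_j)\|^2+\frac{\sigma_1}{\sqrt2}\|\sin\angle_B(\widetilde{\mathcal{X}}_{j'},\mathcal{X}_j)\|_F^2$$ and $$|\theta_{j'}-\sigma_j|\le(\sigma_1+\sigma_j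)\|\sin\angle_B(\widetilde{\mathcal{X}}_{j'},\mathcal{X}_j)\|^2.$$
   Context: Norms: $\|x\|_B=\sqrt{x^{T}Bx}$ for real $x$; $\|\cdot\|$ is the $2$-norm and $\|\cdot\|_F$ the Frobenius norm; $M=B^{1/2}$ is the symmetric positive definite square root of $B$. Spectral data: the nonzero eigenvalues of $(A,B)$ (i.e. $\lambda$ with $Ax=\lambda Bx$, $x\ne0$) are $\pm\mathrm{i}\sigma_j$, $j=1,\dots,\ell$, where $2\ell=\mathrm{rank}(A)$, with eigenvectors $\frac{1}{\sqrt2}(u_j\pm\mathrm{i}v_j)$, where $u_j,v_j\in\mathbb{R}^n$ satisfy $Av_j=\sigma_jBu_j$, $Au_j=-\sigma_jBv_j$, and $u_1,\dots,u_\ell,v_1,\dots,v_\ell$ are $B$-orthonormal. $(\sigma_j,u_j,v_j)$ is called a generalized spectral triplet of $(A,B)$. $m$-step GSSLBD process: set $\beta_0=0$, $p_0=0$; for $j=1,\dots,m$: $s_j=B^{-1}Aq_j-\beta_{j-1}p_{j-1}$, $\alpha_j=\|s_j\|_B$, $p_j=s_j/\alpha_j$; $t_j=-B^{-1}Ap_j-\alpha_jq_j$, $\beta_j=\|t_j\|_B$, $q_{j+1}=t_j/\beta_j$. It breaks down if some $\alpha_j=0$ or $\beta_j=0$. When it does not break down, $P_m=[p_1,\dots,p_m]$ and $Q_m=[q_1,\dots,q_m]$ have $B$-orthonormal columns and $P_m^{T}BQ_m=0$. Ritz approximations: let $G_m\in\mathbb{R}^{m\times m}$ be the upper bidiagonal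 matrix with diagonal $\alpha_1,\dots,\alpha_m$ and superdiagonal $\beta_1,\dots,\beta_{m-1}$, and let $(\theta_i,c_i,d_i)$, $i=1,\dots,m$, be its singular triplets: $G_md_i=\theta_ic_i$, $G_m^{T}c_i=\theta_id_i$, $\|c_i\|=\|d_i\|=1$, $\theta_1>\theta_2>\dots>\theta_m$. The generalized Ritz approximations are $(\theta_i,\tilde u_i,\tilde v_i)$ with $\tilde u_i=P_mc_i$, $\tilde v_i=Q_md_i$; the $\theta_i$ are the Ritz values. Angles: for subspaces $\mathcal{W},\mathcal{Z}\subseteq\mathbb{R}^n$, $\angle_B(\mathcal{W},\mathcal{Z})=\angle(M\mathcal{W},M\mathcal{Z})$, where $\angle(\cdot,\cdot)$ denotes the usual (Euclidean) canonical angles; for nonzero vectors $x,y$, $\angle_B(x,y)=\angle(Mx,My)$ is the angle between the vectors $Mx$ and $My$. $\|\sin\angle_B(\mathcal{W},\mathcal{Z})\|=\|\widetilde W_{\perp_B}^{T}B\widetilde Z\|$ and $\|\sin\angle_B(\mathcal{W},\mathcal{Z})\|_F=\|\widetilde W_{\perp_B}^{T}B\widetilde Z\|_F$, where $\widetilde W,\widetilde Z$ are matrices whose columns form $B$-orthonormal bases of $\mathcal{W},\mathcal{Z}$ and $\widetilde W_{\perp_B}$ is such that $[\widetilde W,\widetilde W_{\perp_B}]$ is square and $[\widetilde W,\widetilde W_{\perp_B}]^{T}B[\widetilde W,\widetilde W_{\perp_B}]=I$. *)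

theory Defs
  imports "HOL-Analysis.Analysis" "HOL-Computational_Algebra.Polynomial"
begin

definition skew_symmetric :: "real^'n^'n \<Rightarrow> bool" where
  "skew_symmetric A \<longleftrightarrow> transpose A = - A"

definition sym_pos_def :: "real^'n^'n \<Rightarrow> bool" where
  "sym_pos_def B \<longleftrightarrow> transpose B = B \<and> (\<forall>x. x \<noteq> 0 \<longrightarrow> x \<bullet> (B *v x) > 0)"

definition B_inner :: "real^'n^'n \<Rightarrow> real^'n \<Rightarrow> real^'n \<Rightarrow> real" where
  "B_inner B x y = x \<bullet> (B *v y)"

definition B_norm :: "real^'n^'n \<Rightarrow> real^'n \<Rightarrow> real" where
  "B_norm B x = sqrt (x \<bullet> (B *v x))"

definition B_orthonormal :: "real^'n^'n \<Rightarrow> ('i \<Rightarrow> real^'n) \<Rightarrow> 'i set \<Rightarrow> bool" where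
  "B_orthonormal B w I \<longleftrightarrow>
     (\<forall>i\<in>I. \<forall>j\<in>I. B_inner B (w i) (w j) = (if i = j then 1 else 0))"

definition spd_sqrt :: "real^'n^'n \<Rightarrow> real^'n^'n" where
  "spd_sqrt B = (THE M. sym_pos_def M \<and> M ** M = B)"

text \<open>The angle lies in \<open>[0, \<pi>]\<close>: no absolute value is taken of the inner product.\<close>

definition vec_angle :: "real^'n \<Rightarrow> real^'n \<Rightarrow> real" where
  "vec_angle x y = arccos (x \<bullet> y / (norm x * norm y))"

definition B_angle :: "real^'n^'n \<Rightarrow> real^'n \<Rightarrow> real^'n \<Rightarrow> real" where
  "B_angle B x y = vec_angle (spd_sqrt B *v x) (spd_sqrt B *v y)"

text \<open>
  An \<open>r \<times> c\<close> real matrix is a function \<open>E\<close> on indices \<open>i \<in> {1..r}\<close>, \<open>j \<in> {1..c}\<close>, a vector of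
  length \<open>k\<close> a function on \<open>{1..k}\<close>; values at other indices are never used.
\<close>

definition nmat_vec :: "nat \<Rightarrow> (nat \<Rightarrow> nat \<Rightarrow> real) \<Rightarrow> (nat \<Rightarrow> real) \<Rightarrow> nat \<Rightarrow> real" where
  "nmat_vec c E x = (\<lambda>i. \<Sum>j=1..c. E i j * x j)"

definition nmat_2norm :: "nat \<Rightarrow> nat \<Rightarrow> (nat \<Rightarrow> nat \<Rightarrow> real) \<Rightarrow> real" where
  "nmat_2norm r c E = Sup {L2_set (nmat_vec c E x) {1..r} | x. L2_set x {1..c} \<le> 1}"

definition nmat_Fnorm :: "nat \<Rightarrow> nat \<Rightarrow> (nat \<Rightarrow> nat \<Rightarrow> real) \<Rightarrow> real" where
  "nmat_Fnorm r c E = sqrt (\<Sum>i=1..r. \<Sum>j=1..c. (E i j)\<^sup>2)"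

text \<open>The product \<open>[w\<^sub>1, \<dots>, w\<^sub>m] c\<close>.\<close>

definition cols_vec :: "nat \<Rightarrow> (nat \<Rightarrow> real^'n) \<Rightarrow> (nat \<Rightarrow> real) \<Rightarrow> real^'n" where
  "cols_vec m w c = (\<Sum>k=1..m. c k *\<^sub>R w k)"

definition is_B_basis :: "real^'n^'n \<Rightarrow> (real^'n) set \<Rightarrow> (nat \<Rightarrow> real^'n) \<Rightarrow> bool" where
  "is_B_basis B W w \<longleftrightarrow> B_orthonormal B w {1..dim W} \<and> span (w ` {1..dim W}) = W"

text \<open>
  The columns \<open>w\<^sub>1, \<dots>, w\<^sub>n\<close> of a square matrix with \<open>[w\<^sub>1, \<dots>, w\<^sub>n]\<^sup>T B [w\<^sub>1, \<dots>, w\<^sub>n] = I\<close>: the first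
  \<open>dim W\<close> of them form a basis of \<open>W\<close>, the others are the columns of the complementary block.
\<close>

definition is_B_full_basis :: "real^'n^'n \<Rightarrow> (real^'n) set \<Rightarrow> (nat \<Rightarrow> real^'n) \<Rightarrow> bool" where
  "is_B_full_basis B W w \<longleftrightarrow> is_B_basis B W w \<and> B_orthonormal B w {1..CARD('n)}"

text \<open>
  The matrix \<open>W\<^sub>\<bottom>\<^sup>T B Z\<close>, of size \<open>(n - dim W) \<times> dim Z\<close>. It depends on the chosen bases, but only up
  to multiplication by orthogonal matrices on both sides, so its norms do not.
\<close>

definition sin_B_angle_mat ::
  "real^'n^'n \<Rightarrow> (real^'n) set \<Rightarrow> (real^'n) set \<Rightarrow> nat \<Rightarrow> nat \<Rightarrow> real" where
  "sin_B_angle_mat B W Z =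
     (let w = (SOME w. is_B_full_basis B W w); z = (SOME z. is_B_basis B Z z)
      in (\<lambda>i j. B_inner B (w (dim W + i)) (z j)))"

definition sin_B_angle_2norm ::
  "real^'n^'n \<Rightarrow> (real^'n) set \<Rightarrow> (real^'n) set \<Rightarrow> real" where
  "sin_B_angle_2norm B W Z = nmat_2norm (CARD('n) - dim W) (dim Z) (sin_B_angle_mat B W Z)"

definition sin_B_angle_Fnorm ::
  "real^'n^'n \<Rightarrow> (real^'n) set \<Rightarrow> (real^'n) set \<Rightarrow> real" where
  "sin_B_angle_Fnorm B W Z = nmat_Fnorm (CARD('n) - dim W) (dim Z) (sin_B_angle_mat B W Z)"

definition gen_eigenvalue :: "real^'n^'n \<Rightarrow> real^'n^'n \<Rightarrow> complex \<Rightarrow> bool" where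
  "gen_eigenvalue A B \<mu> \<longleftrightarrow>
     (\<exists>x. x \<noteq> 0 \<and> map_matrix complex_of_real A *v x = \<mu> *s (map_matrix complex_of_real B *v x))"

text \<open>\<open>det (\<mu>B - A)\<close> as a polynomial in \<open>\<mu>\<close>.\<close>

definition gen_charpoly :: "real^'n^'n \<Rightarrow> real^'n^'n \<Rightarrow> complex poly" where
  "gen_charpoly A B =
     det (\<chi> i j. [: - complex_of_real (A $ i $ j), complex_of_real (B $ i $ j) :])"

definition simple_gen_eigenvalue :: "real^'n^'n \<Rightarrow> real^'n^'n \<Rightarrow> complex \<Rightarrow> bool" where
  "simple_gen_eigenvalue A B \<mu> \<longleftrightarrow> gen_eigenvalue A B \<mu> \<and> order \<mu> (gen_charpoly A B) = 1"

definition nonzero_spectrum ::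
  "real^'n^'n \<Rightarrow> real^'n^'n \<Rightarrow> nat \<Rightarrow> (nat \<Rightarrow> real) \<Rightarrow> bool" where
  "nonzero_spectrum A B l \<sigma> \<longleftrightarrow>
     2 * l = rank A \<and>
     {\<mu>. \<mu> \<noteq> 0 \<and> gen_eigenvalue A B \<mu>} =
       (\<Union>j\<in>{1..l}. {\<i> * complex_of_real (\<sigma> j), - \<i> * complex_of_real (\<sigma> j)})"

text \<open>
  The two real equations say that \<open>(u\<^sub>j \<plusminus> \<i> v\<^sub>j) / \<surd>2\<close> are eigenvectors for \<open>\<plusminus> \<i> \<sigma>\<^sub>j\<close>.
  \<open>Inl j\<close> and \<open>Inr j\<close> index the concatenated family \<open>u\<^sub>1, \<dots>, u\<^sub>l, v\<^sub>1, \<dots>, v\<^sub>l\<close>.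
\<close>

definition gen_spectral_triplets ::
  "real^'n^'n \<Rightarrow> real^'n^'n \<Rightarrow> nat \<Rightarrow> (nat \<Rightarrow> real) \<Rightarrow> (nat \<Rightarrow> real^'n) \<Rightarrow> (nat \<Rightarrow> real^'n) \<Rightarrow> bool"
where
  "gen_spectral_triplets A B l \<sigma> u v \<longleftrightarrow>
     (\<forall>j\<in>{1..l}. A *v v j = \<sigma> j *\<^sub>R (B *v u j) \<and> A *v u j = - \<sigma> j *\<^sub>R (B *v v j)) \<and>
     B_orthonormal B (case_sum u v) ({1..l} <+> {1..l})"

text \<open>Without breakdown the divisions are by nonzero numbers.\<close>

definition gsslbd ::
  "real^'n^'n \<Rightarrow> real^'n^'n \<Rightarrow> nat \<Rightarrow> (nat \<Rightarrow> real^'n) \<Rightarrow> (nat \<Rightarrow> real^'n) \<Rightarrow>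
   (nat \<Rightarrow> real^'n) \<Rightarrow> (nat \<Rightarrow> real^'n) \<Rightarrow> (nat \<Rightarrow> real) \<Rightarrow> (nat \<Rightarrow> real) \<Rightarrow> bool" where
  "gsslbd A B m p q s t \<alpha> \<beta> \<longleftrightarrow>
     \<beta> 0 = 0 \<and> p 0 = 0 \<and>
     (\<forall>j\<in>{1..m}.
        s j = matrix_inv B *v (A *v q j) - \<beta> (j - 1) *\<^sub>R p (j - 1) \<and>
        \<alpha> j = B_norm B (s j) \<and>
        p j = s j /\<^sub>R \<alpha> j \<and>
        t j = - (matrix_inv B *v (A *v p j)) - \<alpha> j *\<^sub>R q j \<and>
        \<beta> j = B_norm B (t j) \<and>
        q (j + 1) = t j /\<^sub>R \<beta> j)"

definition no_breakdown :: "nat \<Rightarrow> (nat \<Rightarrow> real) \<Rightarrow> (nat \<Rightarrow> real) \<Rightarrow> bool" where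
  "no_breakdown m \<alpha> \<beta> \<longleftrightarrow> (\<forall>j\<in>{1..m}. \<alpha> j \<noteq> 0 \<and> \<beta> j \<noteq> 0)"

definition upper_bidiag :: "(nat \<Rightarrow> real) \<Rightarrow> (nat \<Rightarrow> real) \<Rightarrow> nat \<Rightarrow> nat \<Rightarrow> real" where
  "upper_bidiag \<alpha> \<beta> i j = (if j = i then \<alpha> i else if j = i + 1 then \<beta> i else 0)"

definition singular_triplets ::
  "nat \<Rightarrow> (nat \<Rightarrow> nat \<Rightarrow> real) \<Rightarrow>
   (nat \<Rightarrow> real) \<Rightarrow> (nat \<Rightarrow> nat \<Rightarrow> real) \<Rightarrow> (nat \<Rightarrow> nat \<Rightarrow> real) \<Rightarrow> bool" where
  "singular_triplets m G \<theta> c d \<longleftrightarrow>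
     (\<forall>i\<in>{1..m}.
        0 \<le> \<theta> i \<and>
        (\<forall>k\<in>{1..m}. nmat_vec m G (d i) k = \<theta> i * c i k) \<and>
        (\<forall>k\<in>{1..m}. nmat_vec m (\<lambda>a b. G b a) (c i) k = \<theta> i * d i k) \<and>
        L2_set (c i) {1..m} = 1 \<and> L2_set (d i) {1..m} = 1) \<and>
     strict_antimono_on {1..m} \<theta>"

end

theory Submission
  imports Defs
begin

text \<open>
  Write \<open>\<langle>x, y\<rangle>\<close> for the inner product \<open>x \<bullet> B y\<close>, let \<open>T = B\<^sup>-\<^sup>1 A\<close>, which is skew for this inner product, and
  let \<open>x, y\<close> be the Ritz vectors and \<open>u, v\<close> the spectral vectors to be compared, with values \<open>\<theta>\<close> and \<open>\<sigma>\<close>.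

  The process keeps its vectors \<open>B\<close>-orthonormal, and \<open>P\<^sup>T A Q\<close> is the bidiagonal matrix. Consequently
  \<open>x, y\<close> are \<open>B\<close>-orthonormal and \<open>\<theta> = \<langle>x, T y\<rangle>\<close> (\<open>ritz_approximation\<close>).

  The plane spanned by \<open>u\<close> and \<open>v\<close> is invariant under \<open>T\<close>, and so is its orthogonal complement. Hence
  \<open>\<theta> = \<sigma> det K + \<langle>x', T y'\<rangle>\<close>, where \<open>K\<close> is the \<open>2 \<times> 2\<close> matrix of coordinates of \<open>x, y\<close> in the plane and
  \<open>x', y'\<close> are the components in the complement (\<open>skew_form_error\<close>). Since \<open>T\<close> has norm \<open>\<sigma>\<^sub>1\<close>, the remainder
  is at most \<open>\<sigma>\<^sub>1 (\<parallel>x'\<parallel>\<^sup>2 + \<parallel>y'\<parallel>\<^sup>2) / 2\<close> (\<open>skew_form_le\<close>), and \<open>\<parallel>x'\<parallel>\<^sup>2 + \<parallel>y'\<parallel>\<^sup>2\<close> is the squared Frobenius norm of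
  the sines. The squared \<open>2\<close>-norm \<open>S\<^sup>2\<close> of the sines is \<open>1 - \<kappa>\<^sup>2\<close> for the smaller singular value \<open>\<kappa>\<close> of \<open>K\<close>;
  so \<open>\<parallel>x'\<parallel>\<^sup>2, \<parallel>y'\<parallel>\<^sup>2 \<le> S\<^sup>2\<close> and \<open>\<bar>det K\<bar> \<ge> \<kappa>\<^sup>2 = 1 - S\<^sup>2\<close> (\<open>two_by_two_singular_value_bound\<close>). Angles of at most
  \<open>\<pi>/4\<close> make the diagonal of \<open>K\<close> dominate, so that \<open>det K \<ge> 0\<close> and \<open>\<sigma> (1 - det K) \<le> \<sigma> S\<^sup>2\<close>.

  The argument yields the factor \<open>\<sigma>\<^sub>1 / 2\<close> on the Frobenius term, which is smaller than \<open>\<sigma>\<^sub>1 / sqrt 2\<close>.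
\<close>

section \<open>Orthonormal families for a positive definite form\<close>

lemma bilinear_B_inner: "bilinear (B_inner B)"
  unfolding bilinear_def B_inner_def
  by (auto intro!: linearI simp: inner_left_distrib inner_right_distrib matrix_vector_right_distrib
      scaleR_matrix_vector_assoc[symmetric] matrix_vector_mult_scaleR)

lemmas B_inner_simps =
  bilinear_ladd[OF bilinear_B_inner] bilinear_radd[OF bilinear_B_inner]
  bilinear_lsub[OF bilinear_B_inner] bilinear_rsub[OF bilinear_B_inner]
  bilinear_lmul[OF bilinear_B_inner] bilinear_rmul[OF bilinear_B_inner]
  bilinear_lzero[OF bilinear_B_inner] bilinear_rzero[OF bilinear_B_inner]
  bilinear_lneg[OF bilinear_B_inner] bilinear_rneg[OF bilinear_B_inner]

lemma B_inner_sum_right: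
  "B_inner B x (\<Sum>i\<in>I. a i *\<^sub>R f i) = (\<Sum>i\<in>I. a i * B_inner B x (f i))"
  by (induction I rule: infinite_finite_induct) (simp_all add: B_inner_simps)

lemma B_inner_sum_left:
  "B_inner B (\<Sum>i\<in>I. a i *\<^sub>R f i) x = (\<Sum>i\<in>I. a i * B_inner B (f i) x)"
  by (induction I rule: infinite_finite_induct) (simp_all add: B_inner_simps)

lemma B_inner_commute:
  assumes "sym_pos_def B" shows "B_inner B x y = B_inner B y x"
proof -
  have "transpose B = B" using assms by (simp add: sym_pos_def_def)
  then have "x \<bullet> (B *v y) = (B *v x) \<bullet> y"
    by (metis dot_lmul_matrix transpose_matrix_vector)
  then show ?thesis by (simp add: B_inner_def inner_commute)
qed

lemma B_inner_pos: "sym_pos_def B \<Longrightarrow> x \<noteq> 0 \<Longrightarrow> 0 < B_inner B x x"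
  by (simp add: sym_pos_def_def B_inner_def)

lemma B_inner_nonneg: "sym_pos_def B \<Longrightarrow> 0 \<le> B_inner B x x"
  by (cases "x = 0") (simp_all add: B_inner_pos less_imp_le B_inner_simps)

lemma B_norm_power2: "sym_pos_def B \<Longrightarrow> (B_norm B x)\<^sup>2 = B_inner B x x"
  using B_inner_nonneg[of B x] by (simp add: B_norm_def B_inner_def)

lemma B_orthonormal_expand:
  assumes on: "B_orthonormal B w I" and "finite I" and x: "x \<in> span (w ` I)"
  shows "x = (\<Sum>i\<in>I. B_inner B (w i) x *\<^sub>R w i)"
  using x
proof (induction rule: span_induct)
  case base
  have "linear (\<lambda>x. x - (\<Sum>i\<in>I. B_inner B (w i) x *\<^sub>R w i))"
    by (rule linearI) (simp_all add: B_inner_simps algebra_simps sum.distrib scaleR_sum_right)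
  then show ?case
    using linear_subspace_kernel by fastforce
next
  case (step y)
  then obtain k where k: "k \<in> I" "y = w k" by auto
  have "(\<Sum>i\<in>I. B_inner B (w i) y *\<^sub>R w i) = (\<Sum>i\<in>I. if i = k then w k else 0)"
    using on k by (intro sum.cong) (auto simp: B_orthonormal_def)
  then show ?case using k assms(2) by simp
qed

lemma B_orthonormal_residual:
  assumes "B_orthonormal B w I" and "finite I" and "k \<in> I"
  shows "B_inner B (w k) (x - (\<Sum>i\<in>I. B_inner B (w i) x *\<^sub>R w i)) = 0"
proof -
  have "(\<Sum>i\<in>I. B_inner B (w i) x * B_inner B (w k) (w i))
      = (\<Sum>i\<in>I. if i = k then B_inner B (w k) x else 0)"
    using assms by (intro sum.cong) (auto simp: B_orthonormal_def)
  then show ?thesis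
    using assms by (simp add: B_inner_simps B_inner_sum_right)
qed

lemma B_orthonormal_pythagoras:
  assumes B: "sym_pos_def B" and on: "B_orthonormal B w I" and fin: "finite I"
  defines "r \<equiv> \<lambda>x. x - (\<Sum>i\<in>I. B_inner B (w i) x *\<^sub>R w i)"
  shows "B_inner B (r x) (r x) = B_inner B x x - (\<Sum>i\<in>I. (B_inner B (w i) x)\<^sup>2)"
proof -
  have "B_inner B (\<Sum>i\<in>I. B_inner B (w i) x *\<^sub>R w i) (r x) = 0"
    unfolding r_def B_inner_sum_left by (simp add: B_orthonormal_residual[OF on fin])
  then have "B_inner B (r x) (r x) = B_inner B x (r x)"
    by (simp add: r_def B_inner_simps)
  also have "\<dots> = B_inner B x x - (\<Sum>i\<in>I. (B_inner B (w i) x)\<^sup>2)"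
    by (simp add: r_def B_inner_simps B_inner_sum_right B_inner_commute[OF B, of x "w _"]
        power2_eq_square)
  finally show ?thesis .
qed

lemma B_orthonormal_bessel:
  assumes "sym_pos_def B" "B_orthonormal B w I" "finite I"
  shows "(\<Sum>i\<in>I. (B_inner B (w i) x)\<^sup>2) \<le> B_inner B x x"
proof -
  have "0 \<le> B_inner B x x - (\<Sum>i\<in>I. (B_inner B (w i) x)\<^sup>2)"
    unfolding B_orthonormal_pythagoras[OF assms, symmetric] by (rule B_inner_nonneg[OF assms(1)])
  then show ?thesis by simp
qed

lemma B_orthonormal_inner_expand:
  assumes "B_orthonormal B w I" "finite I" "x \<in> span (w ` I)"
  shows "B_inner B x y = (\<Sum>i\<in>I. B_inner B (w i) x * B_inner B (w i) y)"
proof -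
  have "B_inner B x y = B_inner B (\<Sum>i\<in>I. B_inner B (w i) x *\<^sub>R w i) y"
    using B_orthonormal_expand[OF assms] by (rule arg_cong)
  then show ?thesis by (simp only: B_inner_sum_left)
qed

text \<open>
  The squared length of the projection of \<open>x\<close> onto a subspace does not depend on the basis. This makes
  the arbitrary choice of bases in the matrix of sines harmless.
\<close>

lemma B_orthonormal_sum_squares_cong:
  assumes B: "sym_pos_def B"
    and w: "B_orthonormal B w I" "finite I" and w': "B_orthonormal B w' J" "finite J"
    and span: "span (w ` I) = span (w' ` J)"
  shows "(\<Sum>i\<in>I. (B_inner B (w i) x)\<^sup>2) = (\<Sum>k\<in>J. (B_inner B (w' k) x)\<^sup>2)"
proof -
  have 1: "B_inner B (w i) x = (\<Sum>k\<in>J. B_inner B (w' k) (w i) * B_inner B (w' k) x)"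
    if "i \<in> I" for i
  proof (rule B_orthonormal_inner_expand[OF w'])
    show "w i \<in> span (w' ` J)" using that unfolding span[symmetric] by (simp add: span_base)
  qed
  have 2: "B_inner B (w' k) x = (\<Sum>i\<in>I. B_inner B (w i) (w' k) * B_inner B (w i) x)"
    if "k \<in> J" for k
  proof (rule B_orthonormal_inner_expand[OF w])
    show "w' k \<in> span (w ` I)" using that unfolding span by (simp add: span_base)
  qed
  have "(\<Sum>i\<in>I. (B_inner B (w i) x)\<^sup>2)
      = (\<Sum>i\<in>I. \<Sum>k\<in>J. B_inner B (w i) x * (B_inner B (w' k) (w i) * B_inner B (w' k) x))"
    unfolding power2_eq_square sum_distrib_left[symmetric]
    by (intro sum.cong refl arg_cong2[of _ _ _ _ times] 1)
  also have "\<dots> = (\<Sum>k\<in>J. \<Sum>i\<in>I. B_inner B (w i) x * (B_inner B (w' k) (w i) * B_inner B (w' k) x))"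
    by (rule sum.swap)
  also have "\<dots> = (\<Sum>k\<in>J. B_inner B (w' k) x * (\<Sum>i\<in>I. B_inner B (w i) (w' k) * B_inner B (w i) x))"
    unfolding sum_distrib_left
    by (intro sum.cong refl) (simp add: B_inner_commute[OF B, of "w' _" "w _"] mult_ac)
  also have "\<dots> = (\<Sum>k\<in>J. (B_inner B (w' k) x)\<^sup>2)"
    unfolding power2_eq_square by (intro sum.cong refl arg_cong2[of _ _ _ _ times] 2[symmetric])
  finally show ?thesis .
qed

lemma B_orthonormal_inj_on:
  assumes "B_orthonormal B w I" shows "inj_on w I"
proof (rule inj_onI)
  fix i j assume ij: "i \<in> I" "j \<in> I" "w i = w j"
  then have "(if i = i then 1 else 0) = (if i = j then 1 else (0::real))"
    using assms unfolding B_orthonormal_def by metis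
  then show "i = j" by (simp split: if_splits)
qed

lemma B_orthonormal_independent:
  assumes on: "B_orthonormal B w I" and fin: "finite I"
  shows "independent (w ` I)"
proof (rule independent_if_scalars_zero)
  fix f x assume 0: "(\<Sum>x\<in>w ` I. f x *\<^sub>R x) = 0" and "x \<in> w ` I"
  then obtain k where k: "k \<in> I" "x = w k" by auto
  have "(\<Sum>i\<in>I. f (w i) *\<^sub>R w i) = 0"
    using 0 by (simp add: sum.reindex B_orthonormal_inj_on[OF on])
  then have "0 = (\<Sum>i\<in>I. f (w i) * B_inner B (w k) (w i))"
    by (metis B_inner_sum_right B_inner_simps(8))
  also have "\<dots> = (\<Sum>i\<in>I. if i = k then f (w k) else 0)"
    using on k by (intro sum.cong) (auto simp: B_orthonormal_def)
  finally show "f x = 0" using k fin by simp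
qed (use fin in simp)

lemma B_orthonormal_dim_span:
  assumes "B_orthonormal B w I" "finite I"
  shows "dim (span (w ` I)) = card I"
  using dim_eq_card_independent[OF B_orthonormal_independent[OF assms]]
    card_image[OF B_orthonormal_inj_on[OF assms(1)]] by simp

lemma B_orthonormal_full_span:
  fixes w :: "'i \<Rightarrow> real^'n"
  assumes "B_orthonormal B w I" "finite I" "card I = CARD('n)"
  shows "span (w ` I) = UNIV"
proof -
  have "dim (w ` I) = DIM(real^'n)"
    using B_orthonormal_dim_span[OF assms(1,2)] assms(3) by simp
  then show ?thesis by (simp only: dim_eq_full)
qed

text \<open>Gram--Schmidt: a vector outside the span of the family, minus its projection, is normalised.\<close>

lemma B_orthonormal_extend:
  fixes w :: "nat \<Rightarrow> real^'n"
  assumes B: "sym_pos_def B" and "k \<le> N" "N \<le> CARD('n)" and "B_orthonormal B w {1..k}"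
  shows "\<exists>w'. (\<forall>i\<in>{1..k}. w' i = w i) \<and> B_orthonormal B w' {1..N}"
  using assms(2,3)
proof (induction N rule: dec_induct)
  case base
  then show ?case using assms(4) by blast
next
  case (step N)
  then obtain w' where w': "\<forall>i\<in>{1..k}. w' i = w i" and on: "B_orthonormal B w' {1..N}"
    by auto
  have "dim (span (w' ` {1..N})) = N"
    using B_orthonormal_dim_span[OF on] by simp
  then have "span (w' ` {1..N}) \<noteq> UNIV"
    using step by (metis Suc_le_eq dim_UNIV less_irrefl DIM_cart DIM_real mult.right_neutral)
  then obtain x where x: "x \<notin> span (w' ` {1..N})" by blast
  define r where "r = x - (\<Sum>i\<in>{1..N}. B_inner B (w' i) x *\<^sub>R w' i)"
  have "(\<Sum>i\<in>{1..N}. B_inner B (w' i) x *\<^sub>R w' i) \<in> span (w' ` {1..N})"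
    by (intro span_sum span_scale span_base) auto
  then have "r \<noteq> 0" using x r_def by auto
  then have pos: "0 < B_inner B r r" by (rule B_inner_pos[OF B])
  have orth: "B_inner B (w' i) r = 0" if "i \<in> {1..N}" for i
    unfolding r_def using that by (intro B_orthonormal_residual[OF on]) auto
  define w'' where "w'' = w'(Suc N := r /\<^sub>R sqrt (B_inner B r r))"
  have "B_orthonormal B w'' {1..Suc N}"
    unfolding B_orthonormal_def
  proof (intro ballI)
    fix i j assume "i \<in> {1..Suc N}" "j \<in> {1..Suc N}"
    then consider "i \<in> {1..N}" "j \<in> {1..N}" | "i \<in> {1..N}" "j = Suc N"
      | "i = Suc N" "j \<in> {1..N}" | "i = Suc N" "j = Suc N"
      by fastforce
    then show "B_inner B (w'' i) (w'' j) = (if i = j then 1 else 0)"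
    proof cases
      case 1
      then show ?thesis using on by (auto simp: w''_def B_orthonormal_def)
    next
      case 2
      then show ?thesis using orth by (auto simp: w''_def B_inner_simps)
    next
      case 3
      then show ?thesis using orth B_inner_commute[OF B] by (auto simp: w''_def B_inner_simps)
    next
      case 4
      have "sqrt (B_inner B r r) * sqrt (B_inner B r r) = B_inner B r r" using pos by simp
      with 4 pos show ?thesis by (simp add: w''_def B_inner_simps divide_simps)
    qed
  qed
  moreover have "\<forall>i\<in>{1..k}. w'' i = w i" using w' step by (auto simp: w''_def)
  ultimately show ?case by blast
qed

section \<open>The symmetric positive definite square root\<close>

lemma quadratic_nonpos_imp_linear_coeff_zero:
  fixes a b :: real
  assumes "\<And>t. 2 * t * a \<le> t\<^sup>2 * b"
  shows "a = 0"
proof (rule ccontr)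
  assume "a \<noteq> 0"
  \<comment> \<open>so small that the quadratic term is at most half of the linear one\<close>
  define t where "t = a / (\<bar>b\<bar> + 1)"
  have "t\<^sup>2 * b \<le> t\<^sup>2 * (\<bar>b\<bar> + 1)" by (intro mult_left_mono) auto
  also have "\<dots> = t * a" by (simp add: t_def power2_eq_square)
  finally have "2 * t * a \<le> t * a" using assms[of t] by linarith
  moreover have "0 < t * a"
  proof -
    have "0 < a\<^sup>2 / (\<bar>b\<bar> + 1)" using \<open>a \<noteq> 0\<close> by (intro divide_pos_pos) auto
    then show ?thesis by (simp add: t_def power2_eq_square)
  qed
  ultimately show False by linarith
qed

text \<open>
  A maximiser \<open>x\<close> of the Rayleigh quotient on an invariant subspace is an eigenvector: the first
  variation of the quotient in the direction \<open>A x - \<lambda> x\<close> has to vanish.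
\<close>

lemma symmetric_eigenvector_in_invariant_subspace:
  fixes A :: "real^'n^'n"
  assumes sym: "\<And>x y. x \<bullet> (A *v y) = (A *v x) \<bullet> y"
    and S: "subspace S" and inv: "\<And>x. x \<in> S \<Longrightarrow> A *v x \<in> S" and "S \<noteq> {0}"
  shows "\<exists>x\<in>S. norm x = 1 \<and> A *v x = (x \<bullet> (A *v x)) *\<^sub>R x"
proof -
  let ?K = "S \<inter> sphere 0 1"
  obtain y where y: "y \<in> S" "y \<noteq> 0" using assms subspace_0 by blast
  then have "y /\<^sub>R norm y \<in> ?K" using S by (simp add: subspace_scale)
  then have "?K \<noteq> {}" by blast
  moreover have "compact ?K" by (simp add: closed_subspace S compact_Int closed_Int_compact)
  moreover have "continuous_on ?K (\<lambda>x. x \<bullet> (A *v x))"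
    by (intro continuous_intros linear_continuous_on linear_linear[THEN iffD2]) simp
  ultimately obtain x where x: "x \<in> ?K" and max: "\<And>y. y \<in> ?K \<Longrightarrow> y \<bullet> (A *v y) \<le> x \<bullet> (A *v x)"
    by (meson continuous_attains_sup)
  define lam where "lam = x \<bullet> (A *v x)"
  have bound: "y \<bullet> (A *v y) \<le> lam * (y \<bullet> y)" if "y \<in> S" for y
  proof (cases "y = 0")
    case False
    have "(y /\<^sub>R norm y) \<bullet> (A *v (y /\<^sub>R norm y)) \<le> lam"
      unfolding lam_def using False that S by (intro max) (simp add: subspace_scale)
    then have "y \<bullet> (A *v y) / (norm y)\<^sup>2 \<le> lam"
      by (simp add: matrix_vector_mult_scaleR divide_simps power2_eq_square)
    then show ?thesis using False by (simp add: divide_simps power2_norm_eq_inner)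
  qed simp
  have xx: "x \<bullet> x = 1" and "x \<in> S" using x by (simp_all add: norm_eq_1)
  define z where "z = A *v x - lam *\<^sub>R x"
  have "z \<in> S" using \<open>x \<in> S\<close> S inv by (simp add: z_def subspace_diff subspace_scale)
  have xz: "x \<bullet> z = 0" by (simp add: z_def inner_diff_right xx lam_def)
  have zA: "z \<bullet> (A *v x) = z \<bullet> z"
    using xz by (simp add: z_def inner_diff_left inner_diff_right inner_commute algebra_simps)
  have "z \<bullet> z = 0"
  proof (rule quadratic_nonpos_imp_linear_coeff_zero)
    fix t
    have "(x + t *\<^sub>R z) \<bullet> (A *v (x + t *\<^sub>R z)) \<le> lam * ((x + t *\<^sub>R z) \<bullet> (x + t *\<^sub>R z))"
      using \<open>x \<in> S\<close> \<open>z \<in> S\<close> S by (intro bound) (simp add: subspace_add subspace_scale)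
    also have "(x + t *\<^sub>R z) \<bullet> (x + t *\<^sub>R z) = 1 + t\<^sup>2 * (z \<bullet> z)"
      using xz by (simp add: inner_left_distrib inner_right_distrib xx power2_eq_square inner_commute)
    finally have "(x + t *\<^sub>R z) \<bullet> (A *v (x + t *\<^sub>R z)) \<le> lam * (1 + t\<^sup>2 * (z \<bullet> z))" .
    moreover have "(x + t *\<^sub>R z) \<bullet> (A *v (x + t *\<^sub>R z))
        = lam + 2 * t * (z \<bullet> z) + t\<^sup>2 * (z \<bullet> (A *v z))"
      using sym[of x z] zA
      by (simp add: matrix_vector_right_distrib matrix_vector_mult_scaleR inner_left_distrib
          inner_right_distrib lam_def power2_eq_square inner_commute algebra_simps)
    ultimately have "lam + 2 * t * (z \<bullet> z) + t\<^sup>2 * (z \<bullet> (A *v z)) \<le> lam * (1 + t\<^sup>2 * (z \<bullet> z))"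
      by (simp only:)
    then show "2 * t * (z \<bullet> z) \<le> t\<^sup>2 * (lam * (z \<bullet> z) - z \<bullet> (A *v z))"
      by (simp add: algebra_simps)
  qed
  then have "A *v x = lam *\<^sub>R x" by (simp add: z_def)
  then show ?thesis using x lam_def by auto
qed

lemma symmetric_orthonormal_eigenbasis:
  fixes A :: "real^'n^'n"
  assumes sym: "\<And>x y. x \<bullet> (A *v y) = (A *v x) \<bullet> y"
    and "subspace S" and "\<And>x. x \<in> S \<Longrightarrow> A *v x \<in> S"
  shows "\<exists>E. finite E \<and> pairwise orthogonal E \<and> span E = S \<and>
           (\<forall>e\<in>E. norm e = 1 \<and> A *v e = (e \<bullet> (A *v e)) *\<^sub>R e)"
  using assms(2,3)
proof (induction "dim S" arbitrary: S rule: less_induct)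
  case less
  show ?case
  proof (cases "S = {0}")
    case True
    then show ?thesis by (intro exI[of _ "{}"]) auto
  next
    case False
    then obtain x where x: "x \<in> S" "norm x = 1" and eig: "A *v x = (x \<bullet> (A *v x)) *\<^sub>R x"
      using symmetric_eigenvector_in_invariant_subspace[OF sym less.prems] by blast
    define T where "T = {y \<in> S. x \<bullet> y = 0}"
    have T: "subspace T"
      using less.prems(1) by (auto simp: T_def subspace_def inner_right_distrib)
    have "A *v y \<in> T" if "y \<in> T" for y
    proof -
      have "x \<bullet> (A *v y) = (x \<bullet> (A *v x)) * (x \<bullet> y)" using sym[of x y] eig by (metis inner_scaleR_left)
      then show ?thesis using that less.prems(2) by (simp add: T_def)
    qed
    moreover have "dim T < dim S"
    proof -
      have "x \<notin> T" using x by (simp add: T_def norm_eq_1)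
      moreover have "T \<subseteq> S" by (auto simp: T_def)
      ultimately have "T \<subset> S" using x by blast
      then show ?thesis using T less.prems(1) by (metis dim_psubset span_eq_iff)
    qed
    ultimately obtain E where E: "finite E" "pairwise orthogonal E" "span E = T"
        and eigE: "\<forall>e\<in>E. norm e = 1 \<and> A *v e = (e \<bullet> (A *v e)) *\<^sub>R e"
      using less.hyps[OF _ T] by blast
    have ET: "E \<subseteq> T" using E(3) span_superset by blast
    have "span (insert x E) = S"
    proof
      show "span (insert x E) \<subseteq> S"
        using x ET less.prems(1) by (intro span_minimal) (auto simp: T_def)
      show "S \<subseteq> span (insert x E)"
      proof
        fix y assume "y \<in> S"
        have "y - (x \<bullet> y) *\<^sub>R x \<in> T"
          using x \<open>y \<in> S\<close> less.prems(1)
          by (simp add: T_def subspace_diff subspace_scale inner_diff_right norm_eq_1)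
        then show "y \<in> span (insert x E)" using E(3) by (auto simp: span_insert)
      qed
    qed
    moreover have "pairwise orthogonal (insert x E)"
      using E(2) ET by (auto simp: pairwise_insert T_def orthogonal_def inner_commute)
    ultimately show ?thesis using E(1) eigE x eig by (intro exI[of _ "insert x E"]) auto
  qed
qed

lemma sym_pos_def_iff:
  "sym_pos_def B \<longleftrightarrow> (\<forall>x y. x \<bullet> (B *v y) = (B *v x) \<bullet> y) \<and> (\<forall>x. x \<noteq> 0 \<longrightarrow> 0 < x \<bullet> (B *v x))"
proof -
  have "transpose B = B \<longleftrightarrow> (\<forall>x y. x \<bullet> (B *v y) = (B *v x) \<bullet> y)"
  proof
    assume "transpose B = B"
    then show "\<forall>x y. x \<bullet> (B *v y) = (B *v x) \<bullet> y" by (metis dot_lmul_matrix transpose_matrix_vector)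
  next
    assume sym: "\<forall>x y. x \<bullet> (B *v y) = (B *v x) \<bullet> y"
    have "transpose B *v x = B *v x" for x
    proof -
      have "(transpose B *v x) \<bullet> y = (B *v x) \<bullet> y" for y
        using sym by (simp add: transpose_matrix_vector dot_lmul_matrix)
      then show ?thesis by (metis vector_eq_rdot)
    qed
    then show "transpose B = B" by (simp add: matrix_eq)
  qed
  then show ?thesis by (simp add: sym_pos_def_def)
qed

lemma sym_pos_def_sqrt_exists:
  fixes B :: "real^'n^'n"
  assumes "sym_pos_def B"
  shows "\<exists>M. sym_pos_def M \<and> M ** M = B"
proof -
  have sym: "x \<bullet> (B *v y) = (B *v x) \<bullet> y" and pos: "x \<noteq> 0 \<Longrightarrow> 0 < x \<bullet> (B *v x)" for x y
    using assms by (auto simp: sym_pos_def_iff)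
  obtain E where E: "finite E" "pairwise orthogonal E" "span E = UNIV"
      and eig: "\<And>e. e \<in> E \<Longrightarrow> norm e = 1 \<and> B *v e = (e \<bullet> (B *v e)) *\<^sub>R e"
    using symmetric_orthonormal_eigenbasis[OF sym subspace_UNIV] by auto
  define \<mu> where "\<mu> e = e \<bullet> (B *v e)" for e
  have \<mu>: "0 < \<mu> e" if "e \<in> E" for e
    using eig[OF that] pos[of e] unfolding \<mu>_def by (metis norm_zero zero_neq_one)
  have expand: "(\<Sum>e\<in>E. (x \<bullet> e) *\<^sub>R e) = x" for x
    using E eig by (intro orthonormal_basis_expand) auto
  have on: "e \<bullet> e' = (if e = e' then 1 else 0)" if "e \<in> E" "e' \<in> E" for e e'
    using E(2) eig that by (auto simp: pairwise_def orthogonal_def norm_eq_1)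
  define f where "f x = (\<Sum>e\<in>E. (sqrt (\<mu> e) * (x \<bullet> e)) *\<^sub>R e)" for x
  define M where "M = matrix f"
  have "linear f"
    by (rule linearI) (simp_all add: f_def inner_left_distrib algebra_simps sum.distrib scaleR_sum_right)
  then have M: "M *v x = f x" for x by (simp add: M_def matrix_works linear_matrix_vector_mul_eq)
  have fe: "f x \<bullet> e = sqrt (\<mu> e) * (x \<bullet> e)" if "e \<in> E" for x e
  proof -
    have "f x \<bullet> e = (\<Sum>e'\<in>E. if e' = e then sqrt (\<mu> e) * (x \<bullet> e) else 0)"
      unfolding f_def inner_sum_left using that by (intro sum.cong) (auto simp: on)
    then show ?thesis using that E(1) by simp
  qed
  have "M ** M = B"
  proof -
    have "f (f x) = B *v x" for x
    proof -
      have "f (f x) = (\<Sum>e\<in>E. (\<mu> e * (x \<bullet> e)) *\<^sub>R e)"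
        unfolding f_def[of "f x"] using fe \<mu>
        by (intro sum.cong) (simp_all add: mult.assoc[symmetric] less_imp_le)
      also have "\<dots> = (\<Sum>e\<in>E. (x \<bullet> e) *\<^sub>R (B *v e))"
        using eig by (intro sum.cong refl) (metis \<mu>_def mult.commute scaleR_scaleR)
      also have "\<dots> = B *v (\<Sum>e\<in>E. (x \<bullet> e) *\<^sub>R e)"
        by (simp add: linear_sum[OF matrix_vector_mul_linear] matrix_vector_mult_scaleR)
      finally show ?thesis using expand by simp
    qed
    then show ?thesis by (simp add: matrix_eq matrix_vector_mul_assoc[symmetric] M)
  qed
  moreover have "sym_pos_def M"
    unfolding sym_pos_def_iff
  proof (intro conjI allI impI)
    fix x y
    show "x \<bullet> (M *v y) = (M *v x) \<bullet> y"
      unfolding M f_def inner_sum_right inner_sum_left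
      by (intro sum.cong refl) (simp add: inner_commute[of _ y] mult_ac)
  next
    fix x :: "real^'n" assume "x \<noteq> 0"
    then obtain e where e: "e \<in> E" "x \<bullet> e \<noteq> 0"
      using expand[of x] by (metis (mono_tags, lifting) scaleR_zero_left sum.neutral)
    have "0 < (\<Sum>e\<in>E. sqrt (\<mu> e) * (x \<bullet> e)\<^sup>2)"
      using e \<mu> E(1) by (intro sum_pos2[of _ e]) (auto intro!: mult_nonneg_nonneg less_imp_le[OF \<mu>])
    then show "0 < x \<bullet> (M *v x)"
      by (simp add: M f_def inner_sum_right power2_eq_square mult.assoc)
  qed
  ultimately show ?thesis by blast
qed

text \<open>
  If \<open>M\<^sup>2 = N\<^sup>2\<close> and \<open>D = M - N\<close>, then \<open>M D + D N = 0\<close>. An eigenvector \<open>e\<close> of the symmetric \<open>D\<close> with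
  eigenvalue \<open>\<lambda>\<close> thus satisfies \<open>\<lambda> (e \<bullet> M e + e \<bullet> N e) = 0\<close>, so \<open>\<lambda> = 0\<close>; as eigenvectors span, \<open>D = 0\<close>.
\<close>

lemma sym_pos_def_sqrt_unique:
  fixes M N :: "real^'n^'n"
  assumes M: "sym_pos_def M" and N: "sym_pos_def N" and eq: "M ** M = N ** N"
  shows "M = N"
proof -
  define D where "D = M - N"
  have Dv: "D *v x = M *v x - N *v x" for x by (simp add: D_def matrix_vector_mult_diff_rdistrib)
  have sym: "x \<bullet> (D *v y) = (D *v x) \<bullet> y" for x y
    using M N by (simp add: Dv inner_diff_left inner_diff_right sym_pos_def_iff)
  obtain E where E: "span E = UNIV"
      and eig: "\<And>e. e \<in> E \<Longrightarrow> norm e = 1 \<and> D *v e = (e \<bullet> (D *v e)) *\<^sub>R e"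
    using symmetric_orthonormal_eigenbasis[OF sym subspace_UNIV] by auto
  have zero: "D *v e = 0" if "e \<in> E" for e
  proof -
    define lam where "lam = e \<bullet> (D *v e)"
    have De: "D *v e = lam *\<^sub>R e" and "e \<noteq> 0" using eig[OF that] by (auto simp: lam_def)
    then have pos: "0 < e \<bullet> (M *v e) + e \<bullet> (N *v e)"
      using M N by (simp add: sym_pos_def_def add_pos_pos)
    have "M *v (M *v e) = N *v (N *v e)" using eq by (simp add: matrix_vector_mul_assoc)
    then have "M *v (D *v e) + D *v (N *v e) = 0"
      by (simp add: Dv matrix_vector_mult_diff_distrib)
    then have "e \<bullet> (M *v (D *v e)) + e \<bullet> (D *v (N *v e)) = 0"
      by (metis inner_add_right inner_zero_right)
    then have "lam * (e \<bullet> (M *v e) + e \<bullet> (N *v e)) = 0"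
      by (simp add: sym[of e "N *v e"] De matrix_vector_mult_scaleR distrib_left)
    then show ?thesis using pos De by simp
  qed
  have "D *v x = 0" for x
    using linear_eq_0_on_span[OF matrix_vector_mul_linear, of E D x] zero E by auto
  then have "M *v x = N *v x" for x by (simp add: Dv)
  then show ?thesis by (simp add: matrix_eq)
qed

lemma spd_sqrt_square:
  assumes "sym_pos_def B"
  shows "sym_pos_def (spd_sqrt B)" and "spd_sqrt B ** spd_sqrt B = B"
proof -
  have "\<exists>!M. sym_pos_def M \<and> M ** M = B"
    using sym_pos_def_sqrt_exists[OF assms] sym_pos_def_sqrt_unique by metis
  then have "sym_pos_def (spd_sqrt B) \<and> spd_sqrt B ** spd_sqrt B = B"
    unfolding spd_sqrt_def by (rule theI')
  then show "sym_pos_def (spd_sqrt B)" and "spd_sqrt B ** spd_sqrt B = B" by auto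
qed

lemma inner_spd_sqrt:
  assumes "sym_pos_def B"
  shows "(spd_sqrt B *v x) \<bullet> (spd_sqrt B *v y) = B_inner B x y"
proof -
  have "(spd_sqrt B *v x) \<bullet> (spd_sqrt B *v y) = x \<bullet> (spd_sqrt B *v (spd_sqrt B *v y))"
    using spd_sqrt_square(1)[OF assms] by (simp add: sym_pos_def_iff)
  then show ?thesis
    by (simp add: matrix_vector_mul_assoc spd_sqrt_square(2)[OF assms] B_inner_def)
qed

lemma B_angle_le_pi_quarter_imp:
  assumes B: "sym_pos_def B" and "B_inner B x x = 1" "B_inner B y y = 1"
    and angle: "B_angle B x y \<le> pi / 4"
  shows "sqrt 2 / 2 \<le> B_inner B x y"
proof -
  let ?M = "spd_sqrt B"
  have norm: "norm (?M *v x) = 1" "norm (?M *v y) = 1"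
    using assms by (simp_all add: norm_eq_1 inner_spd_sqrt)
  then have abs: "\<bar>B_inner B x y\<bar> \<le> 1"
    using Cauchy_Schwarz_ineq2[of "?M *v x" "?M *v y"] by (simp add: inner_spd_sqrt[OF B])
  have "arccos (B_inner B x y) \<le> pi / 4"
    using angle norm by (simp add: B_angle_def vec_angle_def inner_spd_sqrt[OF B])
  then have "cos (pi / 4) \<le> cos (arccos (B_inner B x y))"
    using abs arccos_lbound[of "B_inner B x y"] by (intro cos_monotone_0_pi_le) auto
  then show ?thesis using abs by (simp add: cos_45)
qed

section \<open>The bidiagonalization process\<close>

lemma skew_symmetric_inner:
  assumes "skew_symmetric A" shows "x \<bullet> (A *v y) = - (y \<bullet> (A *v x))"
proof -
  have "x \<bullet> (A *v y) = (transpose A *v x) \<bullet> y"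
    by (metis dot_lmul_matrix transpose_matrix_vector)
  also have "\<dots> = - (y \<bullet> (A *v x))"
    using assms by (simp add: skew_symmetric_def inner_commute linear_neg
        matrix_vector_mult_def inner_vec_def sum_negf)
  finally show ?thesis .
qed

lemma sym_pos_def_mult_matrix_inv:
  assumes "sym_pos_def B" shows "B *v (matrix_inv B *v x) = x"
proof -
  have "x = 0" if "B *v x = 0" for x
    using B_inner_pos[OF assms, of x] that by (auto simp: B_inner_def)
  then have "invertible B"
    by (simp add: invertible_left_inverse matrix_left_invertible_ker)
  then have "B ** matrix_inv B = mat 1"
    unfolding invertible_def matrix_inv_def by (rule someI2_ex) simp
  then show ?thesis by (simp add: matrix_vector_mul_assoc)
qed

text \<open>
  The vectors \<open>q\<^sub>1, p\<^sub>1, q\<^sub>2, p\<^sub>2, \<dots>\<close> satisfy a single three-term recurrence for \<open>B\<^sup>-\<^sup>1 A\<close> whose sign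
  alternates. As for the Lanczos process, pairing the recurrence of one vector with another vector
  and moving the skew operator across gives orthogonality.
\<close>

lemma alternating_skew_recurrence_orthonormal:
  fixes z :: "nat \<Rightarrow> real^'n" and \<gamma> :: "nat \<Rightarrow> real"
  defines "\<epsilon> \<equiv> \<lambda>k::nat. if odd k then 1 else - 1 :: real"
  assumes A: "skew_symmetric A" and B: "sym_pos_def B"
    and norm: "\<And>k. k \<in> {1..Suc N} \<Longrightarrow> B_inner B (z k) (z k) = 1"
    and \<gamma>0: "\<gamma> 0 = 0" and \<gamma>: "\<And>k. k \<in> {1..N} \<Longrightarrow> \<gamma> k \<noteq> 0"
    and rec: "\<And>k. k \<in> {1..N} \<Longrightarrow>
        A *v z k = \<epsilon> k *\<^sub>R (B *v (\<gamma> k *\<^sub>R z (Suc k) + \<gamma> (k - 1) *\<^sub>R z (k - 1)))"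
  shows "B_orthonormal B z {1..Suc N}"
proof -
  have pair: "x \<bullet> (A *v z k) =
      \<epsilon> k * (\<gamma> k * B_inner B x (z (Suc k)) + \<gamma> (k - 1) * B_inner B x (z (k - 1)))"
    if "k \<in> {1..N}" for k x
    using rec[OF that] by (simp add: B_inner_def matrix_vector_right_distrib
        matrix_vector_mult_scaleR inner_right_distrib)
  have "\<forall>i j. 1 \<le> i \<longrightarrow> i < j \<longrightarrow> j \<le> K \<longrightarrow> B_inner B (z i) (z j) = 0" if "K \<le> Suc N" for K
    using that
  proof (induction K)
    case 0
    then show ?case by simp
  next
    case (Suc k)
    have IH: "B_inner B (z i) (z j) = 0" if "1 \<le> i" "1 \<le> j" "i \<le> k" "j \<le> k" "i \<noteq> j" for i j
      using that Suc B_inner_commute[OF B, of "z i" "z j"]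
      by (metis Suc_leD linorder_neqE_nat)
    have new: "B_inner B (z i) (z (Suc k)) = 0" if i: "1 \<le> i" "i \<le> k" for i
    proof -
      have k: "k \<in> {1..N}" and iN: "i \<in> {1..N}" using i Suc.prems by auto
      have skew: "z i \<bullet> (A *v z k) = - (z k \<bullet> (A *v z i))"
        by (rule skew_symmetric_inner[OF A])
      have low: "\<gamma> (i - 1) * B_inner B (z k) (z (i - 1)) = 0"
        using \<gamma>0 IH[of k "i - 1"] i by (cases "i = 1") auto
      have \<epsilon>: "\<epsilon> k \<noteq> 0" by (simp add: \<epsilon>_def)
      consider "i = k" | "Suc i = k" | "Suc i < k" using i by linarith
      then have "\<epsilon> k * (\<gamma> k * B_inner B (z i) (z (Suc k))) = 0"
      proof cases
        case 1
        then have "z k \<bullet> (A *v z k) = 0" using skew by simp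
        then show ?thesis using pair[OF k, of "z k"] low 1 by (auto simp: algebra_simps)
      next
        case 2
        then have "\<epsilon> k = - \<epsilon> i" "B_inner B (z i) (z i) = 1" "B_inner B (z k) (z k) = 1"
          using iN k norm[of i] norm[of k] by (auto simp: \<epsilon>_def)
        then show ?thesis
          using skew low 2 unfolding pair[OF k] pair[OF iN] by (auto simp: algebra_simps)
      next
        case 3
        then have "B_inner B (z i) (z (k - 1)) = 0" "B_inner B (z k) (z (Suc i)) = 0"
          using i by (auto intro!: IH)
        then show ?thesis using skew low unfolding pair[OF k] pair[OF iN] by simp
      qed
      then show ?thesis using \<epsilon> \<gamma>[OF k] by simp
    qed
    show ?case
    proof (intro allI impI)
      fix i j assume "1 \<le> i" "i < j" "j \<le> Suc k"
      then show "B_inner B (z i) (z j) = 0"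
        using new IH by (cases "j = Suc k") auto
    qed
  qed
  from this[of "Suc N"] have orth: "B_inner B (z i) (z j) = 0" if "1 \<le> i" "i < j" "j \<le> Suc N" for i j
    using that by blast
  show ?thesis
    unfolding B_orthonormal_def
  proof (intro ballI)
    fix i j assume "i \<in> {1..Suc N}" "j \<in> {1..Suc N}"
    then show "B_inner B (z i) (z j) = (if i = j then 1 else 0)"
      using orth[of i j] orth[of j i] norm[of i] B_inner_commute[OF B, of "z i" "z j"]
      by (cases i j rule: linorder_cases) auto
  qed
qed

lemma B_inner_normalized:
  assumes "sym_pos_def B" "B_norm B s \<noteq> 0"
  shows "B_inner B (s /\<^sub>R B_norm B s) (s /\<^sub>R B_norm B s) = 1"
  using assms by (simp add: B_inner_simps B_norm_power2[symmetric] power2_eq_square field_simps)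

lemma gsslbd_recurrences:
  assumes B: "sym_pos_def B" and gs: "gsslbd A B m p q s t \<alpha> \<beta>" and nb: "no_breakdown m \<alpha> \<beta>"
    and k: "k \<in> {1..m}"
  shows "A *v q k = B *v (\<alpha> k *\<^sub>R p k + \<beta> (k - 1) *\<^sub>R p (k - 1))"
    and "A *v p k = - (B *v (\<alpha> k *\<^sub>R q k + \<beta> k *\<^sub>R q (Suc k)))"
    and "B_inner B (p k) (p k) = 1" and "B_inner B (q (Suc k)) (q (Suc k)) = 1"
proof -
  have ne: "\<alpha> k \<noteq> 0" "\<beta> k \<noteq> 0" using nb k by (auto simp: no_breakdown_def)
  have s: "s k = matrix_inv B *v (A *v q k) - \<beta> (k - 1) *\<^sub>R p (k - 1)" "\<alpha> k = B_norm B (s k)"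
      "p k = s k /\<^sub>R \<alpha> k"
    and t: "t k = - (matrix_inv B *v (A *v p k)) - \<alpha> k *\<^sub>R q k" "\<beta> k = B_norm B (t k)"
      "q (Suc k) = t k /\<^sub>R \<beta> k"
    using gs k by (auto simp: gsslbd_def)
  have "\<alpha> k *\<^sub>R p k + \<beta> (k - 1) *\<^sub>R p (k - 1) = matrix_inv B *v (A *v q k)"
    using s(1,3) ne by simp
  then show "A *v q k = B *v (\<alpha> k *\<^sub>R p k + \<beta> (k - 1) *\<^sub>R p (k - 1))"
    by (simp add: sym_pos_def_mult_matrix_inv[OF B])
  have "\<alpha> k *\<^sub>R q k + \<beta> k *\<^sub>R q (Suc k) = - (matrix_inv B *v (A *v p k))"
    using t(1,3) ne by simp
  then have "B *v (\<alpha> k *\<^sub>R q k + \<beta> k *\<^sub>R q (Suc k)) = B *v (- (matrix_inv B *v (A *v p k)))"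
    by simp
  then show "A *v p k = - (B *v (\<alpha> k *\<^sub>R q k + \<beta> k *\<^sub>R q (Suc k)))"
    by (simp add: sym_pos_def_mult_matrix_inv[OF B] linear_neg[OF matrix_vector_mul_linear])
  show "B_inner B (p k) (p k) = 1" and "B_inner B (q (Suc k)) (q (Suc k)) = 1"
    unfolding s(3) t(3) using B_inner_normalized[OF B] ne s(2) t(2) by metis+
qed

lemma gsslbd_orthonormal:
  assumes A: "skew_symmetric A" and B: "sym_pos_def B" and q1: "B_norm B (q 1) = 1"
    and gs: "gsslbd A B m p q s t \<alpha> \<beta>" and nb: "no_breakdown m \<alpha> \<beta>"
  shows "B_orthonormal B (case_sum p q) ({1..m} <+> {1..m})"
proof -
  \<comment> \<open>The sequence \<open>q\<^sub>1, p\<^sub>1, q\<^sub>2, p\<^sub>2, \<dots>\<close> starts at index 1; \<open>z\<^sub>0 = p\<^sub>0\<close> only occurs with the factor \<open>\<beta>\<^sub>0 = 0\<close>.\<close>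
  define z where "z k = (if odd k then q (Suc k div 2) else p (k div 2))" for k
  define \<gamma> where "\<gamma> k = (if odd k then \<alpha> (Suc k div 2) else \<beta> (k div 2))" for k
  note rec = gsslbd_recurrences[OF B gs nb]
  have qq: "B_inner B (q k) (q k) = 1" if "k \<in> {1..Suc m}" for k
  proof (cases "k = 1")
    case True
    then show ?thesis using q1 B_norm_power2[OF B, of "q 1"] by simp
  next
    case False
    then have "k = Suc (k - 1)" "k - 1 \<in> {1..m}" using that by auto
    then show ?thesis using rec(4) by metis
  qed
  have "B_orthonormal B z {1..Suc (2 * m)}"
  proof (rule alternating_skew_recurrence_orthonormal[OF A B])
    fix k assume k: "k \<in> {1..Suc (2 * m)}"
    show "B_inner B (z k) (z k) = 1"
    proof (cases "odd k")
      case True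
      then have "Suc k div 2 \<in> {1..Suc m}" using k by auto
      then show ?thesis using True qq by (simp add: z_def)
    next
      case False
      then have "k div 2 \<in> {1..m}" using k by auto
      then show ?thesis using False rec(3) by (simp add: z_def)
    qed
  next
    show "\<gamma> 0 = 0" using gs by (simp add: \<gamma>_def gsslbd_def)
  next
    fix k assume k: "k \<in> {1..2 * m}"
    then have half: "odd k \<Longrightarrow> Suc k div 2 \<in> {1..m}" "even k \<Longrightarrow> k div 2 \<in> {1..m}"
      by (auto elim!: oddE)
    then show "\<gamma> k \<noteq> 0" using nb by (auto simp: \<gamma>_def no_breakdown_def)
    show "A *v z k = (if odd k then 1 else - 1) *\<^sub>R
        (B *v (\<gamma> k *\<^sub>R z (Suc k) + \<gamma> (k - 1) *\<^sub>R z (k - 1)))"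
    proof (cases "odd k")
      case True
      then obtain j where j: "k = 2 * j + 1" by (rule oddE)
      then show ?thesis using rec(1)[of "Suc j"] half(1) True by (simp add: z_def \<gamma>_def)
    next
      case False
      then obtain j where j: "k = 2 * j" by auto
      then have jm: "j \<in> {1..m}" using k by auto
      then have "odd (k - 1)" "Suc (k - 1) div 2 = j" using j by auto
      then show ?thesis using rec(2)[OF jm] j by (simp add: z_def \<gamma>_def add.commute)
    qed
  qed
  moreover have "z (2 * k) = p k" "k \<in> {1..m} \<Longrightarrow> z (2 * k - 1) = q k" for k
    by (auto simp: z_def)
  then have "case_sum p q x = z (case_sum (\<lambda>k. 2 * k) (\<lambda>k. 2 * k - 1) x)"
    if "x \<in> {1..m} <+> {1..m}" for x using that by auto
  moreover have "inj_on (case_sum (\<lambda>k. 2 * k) (\<lambda>k. 2 * k - 1)) ({1..m} <+> {1..m})"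
    by (auto simp: inj_on_def) presburger+
  moreover have "case_sum (\<lambda>k. 2 * k) (\<lambda>k. 2 * k - 1) x \<in> {1..Suc (2 * m)}"
    if "x \<in> {1..m} <+> {1..m}" for x using that by auto
  ultimately show ?thesis
    unfolding B_orthonormal_def by (simp add: inj_on_eq_iff)
qed

lemma B_orthonormal_sumD:
  assumes "B_orthonormal B (case_sum f g) (I <+> J)"
  shows "B_orthonormal B f I" and "B_orthonormal B g J"
    and "\<And>i j. i \<in> I \<Longrightarrow> j \<in> J \<Longrightarrow> B_inner B (f i) (g j) = 0"
proof -
  have *: "B_inner B (case_sum f g a) (case_sum f g b) = (if a = b then 1 else 0)"
    if "a \<in> I <+> J" "b \<in> I <+> J" for a b
    using assms that by (simp add: B_orthonormal_def)
  show "B_orthonormal B f I" unfolding B_orthonormal_def using *[OF InlI InlI] by auto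
  show "B_orthonormal B g J" unfolding B_orthonormal_def using *[OF InrI InrI] by auto
  show "B_inner B (f i) (g j) = 0" if "i \<in> I" "j \<in> J" for i j
    using *[OF InlI InrI, of i j] that by simp
qed

text \<open>
  The recurrence expresses \<open>A q\<^sub>k\<close> through \<open>B p\<^sub>k\<close> and \<open>B p\<^sub>k\<^sub>-\<^sub>1\<close>, so orthonormality of the \<open>p\<^sub>i\<close> leaves two
  diagonals of \<open>P\<^sup>T A Q\<close>.
\<close>

lemma gsslbd_projection:
  assumes A: "skew_symmetric A" and B: "sym_pos_def B" and q1: "B_norm B (q 1) = 1"
    and gs: "gsslbd A B m p q s t \<alpha> \<beta>" and nb: "no_breakdown m \<alpha> \<beta>"
    and ik: "i \<in> {1..m}" "k \<in> {1..m}"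
  shows "p i \<bullet> (A *v q k) = upper_bidiag \<alpha> \<beta> i k"
proof -
  have on: "B_orthonormal B p {1..m}"
    using B_orthonormal_sumD(1)[OF gsslbd_orthonormal[OF A B q1 gs nb]] .
  have "p i \<bullet> (A *v q k) = \<alpha> k * B_inner B (p i) (p k) + \<beta> (k - 1) * B_inner B (p i) (p (k - 1))"
    unfolding gsslbd_recurrences(1)[OF B gs nb ik(2)] B_inner_def[symmetric]
    by (simp add: B_inner_simps)
  moreover have "\<beta> 0 = 0" using gs by (simp add: gsslbd_def)
  moreover have "B_inner B (p i) (p k) = (if i = k then 1 else 0)"
    using on ik by (simp add: B_orthonormal_def)
  moreover have "B_inner B (p i) (p (k - 1)) = (if i = k - 1 then 1 else 0)" if "k \<noteq> 1"
  proof -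
    have "k - 1 \<in> {1..m}" using ik that by auto
    then show ?thesis using on ik unfolding B_orthonormal_def by blast
  qed
  ultimately show ?thesis
    using ik by (cases "k = 1") (auto simp: upper_bidiag_def)
qed

lemma cols_vec_inner:
  assumes "B_orthonormal B w {1..m}"
  shows "B_inner B (cols_vec m w c) (cols_vec m w c) = (L2_set c {1..m})\<^sup>2"
proof -
  have "B_inner B (cols_vec m w c) (cols_vec m w c)
      = (\<Sum>i=1..m. \<Sum>k=1..m. if k = i then c i * c k else 0)"
    unfolding cols_vec_def B_inner_sum_left unfolding B_inner_sum_right sum_distrib_left
    using assms by (intro sum.cong refl) (auto simp: B_orthonormal_def)
  also have "\<dots> = (\<Sum>i=1..m. (c i)\<^sup>2)"
    by (intro sum.cong refl) (simp add: power2_eq_square)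
  finally show ?thesis by (simp add: L2_set_def sum_nonneg)
qed

text \<open>
  With \<open>G = P\<^sup>T A Q\<close> and \<open>G\<^sup>T c = \<theta> d\<close> the last claim reads \<open>x \<bullet> A y = c\<^sup>T P\<^sup>T A Q d = (G\<^sup>T c)\<^sup>T d = \<theta> d\<^sup>T d\<close>.
\<close>

lemma ritz_approximation:
  assumes A: "skew_symmetric A" and B: "sym_pos_def B" and q1: "B_norm B (q 1) = 1"
    and gs: "gsslbd A B m p q s t \<alpha> \<beta>" and nb: "no_breakdown m \<alpha> \<beta>"
    and sv: "singular_triplets m (upper_bidiag \<alpha> \<beta>) \<theta> c d" and i: "i \<in> {1..m}"
  defines "x \<equiv> cols_vec m p (c i)" and "y \<equiv> cols_vec m q (d i)"
  shows "B_inner B x x = 1" and "B_inner B y y = 1" and "B_inner B x y = 0"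
    and "x \<bullet> (A *v y) = \<theta> i"
proof -
  note on = B_orthonormal_sumD[OF gsslbd_orthonormal[OF A B q1 gs nb]]
  have G: "nmat_vec m (\<lambda>a b. upper_bidiag \<alpha> \<beta> b a) (c i) k = \<theta> i * d i k" if "k \<in> {1..m}" for k
    using sv i that by (simp add: singular_triplets_def)
  have c1: "L2_set (c i) {1..m} = 1" and d1: "L2_set (d i) {1..m} = 1"
    using sv i by (simp_all add: singular_triplets_def)
  show "B_inner B x x = 1" "B_inner B y y = 1"
    unfolding x_def y_def cols_vec_inner[OF on(1)] cols_vec_inner[OF on(2)] c1 d1 by simp_all
  show "B_inner B x y = 0"
    unfolding x_def y_def cols_vec_def B_inner_sum_left unfolding B_inner_sum_right
    by (simp add: on(3))
  have "x \<bullet> (A *v q k) = \<theta> i * d i k" if "k \<in> {1..m}" for k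
  proof -
    have "x \<bullet> (A *v q k) = (\<Sum>a=1..m. c i a * (p a \<bullet> (A *v q k)))"
      by (simp add: x_def cols_vec_def inner_sum_left)
    also have "\<dots> = (\<Sum>a=1..m. upper_bidiag \<alpha> \<beta> a k * c i a)"
      using that by (intro sum.cong) (simp_all add: gsslbd_projection[OF A B q1 gs nb])
    finally show ?thesis using G[OF that] by (simp add: nmat_vec_def)
  qed
  then have "x \<bullet> (A *v y) = (\<Sum>k=1..m. d i k * (\<theta> i * d i k))"
    by (simp add: y_def cols_vec_def linear_sum[OF matrix_vector_mul_linear]
        matrix_vector_mult_scaleR inner_sum_right)
  also have "\<dots> = \<theta> i * (\<Sum>k=1..m. (d i k)\<^sup>2)"
    by (simp add: sum_distrib_left power2_eq_square mult_ac)
  also have "(\<Sum>k=1..m. (d i k)\<^sup>2) = 1"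
    using d1 by (simp add: L2_set_def)
  finally show "x \<bullet> (A *v y) = \<theta> i" by simp
qed

section \<open>A norm bound from the spectral data\<close>

text \<open>
  The vectors \<open>B u\<^sub>k\<close> and \<open>B v\<^sub>k\<close> lie in the range of \<open>A\<close>, and there are \<open>rank A\<close> many of them. They
  span the range, so the kernel of \<open>A\<close> is the \<open>B\<close>-orthogonal complement of all \<open>u\<^sub>k\<close> and \<open>v\<^sub>k\<close>.
\<close>

lemma mult_eq_0_if_B_orthogonal_triplets:
  fixes A B :: "real^'n^'n"
  assumes A: "skew_symmetric A" and B: "sym_pos_def B" and rank: "rank A = 2 * l"
    and trip: "gen_spectral_triplets A B l \<sigma> u v" and pos: "\<forall>k\<in>{1..l}. 0 < \<sigma> k"
    and y: "\<And>k. k \<in> {1..l} \<Longrightarrow> B_inner B (u k) y = 0" "\<And>k. k \<in> {1..l} \<Longrightarrow> B_inner B (v k) y = 0"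
  shows "A *v y = 0"
proof -
  let ?I = "{1..l} <+> {1..l}" and ?w = "case_sum u v"
  have on: "B_orthonormal B ?w ?I"
    and Auv: "\<And>k. k \<in> {1..l} \<Longrightarrow> A *v v k = \<sigma> k *\<^sub>R (B *v u k)"
      "\<And>k. k \<in> {1..l} \<Longrightarrow> A *v u k = - \<sigma> k *\<^sub>R (B *v v k)"
    using trip by (auto simp: gen_spectral_triplets_def)
  let ?W = "span (?w ` ?I)" and ?R = "range (\<lambda>x. A *v x)"
  have inj: "inj (\<lambda>x. B *v x)"
  proof (rule injI)
    fix x y assume "B *v x = B *v y"
    then have "B_inner B (x - y) (x - y) = 0"
      by (simp add: B_inner_def matrix_vector_mult_diff_distrib)
    then show "x = y" using B_inner_pos[OF B, of "x - y"] by auto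
  qed
  have "dim ((\<lambda>x. B *v x) ` ?W) = dim ?W"
    by (intro dim_image_eq matrix_vector_mul_linear inj_on_subset[OF inj]) auto
  also have "\<dots> = 2 * l" using B_orthonormal_dim_span[OF on] by (simp add: card_Plus)
  finally have dimBW: "dim ((\<lambda>x. B *v x) ` ?W) = dim ?R" using rank by (simp add: rank_dim_range)
  have R: "subspace ?R" by (intro linear_subspace_image matrix_vector_mul_linear subspace_UNIV)
  have "(\<lambda>x. B *v x) ` ?W \<subseteq> ?R"
  proof -
    have "B *v ?w i \<in> ?R" if "i \<in> ?I" for i
    proof (cases i)
      case (Inl k)
      then have "B *v ?w i = A *v (v k /\<^sub>R \<sigma> k)"
        using Auv(1)[of k] pos that by (auto simp: matrix_vector_mult_scaleR)
      then show ?thesis by blast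
    next
      case (Inr k)
      then have "B *v ?w i = (- 1 / \<sigma> k) *\<^sub>R (A *v u k)"
        using Auv(2)[of k] pos that by auto
      also have "\<dots> = A *v ((- 1 / \<sigma> k) *\<^sub>R u k)" by (simp only: matrix_vector_mult_scaleR)
      finally show ?thesis by blast
    qed
    then have "span ((\<lambda>x. B *v x) ` ?w ` ?I) \<subseteq> ?R" by (intro span_minimal R) auto
    then show ?thesis by (simp add: linear_span_image[OF matrix_vector_mul_linear])
  qed
  then have RW: "(\<lambda>x. B *v x) ` ?W = ?R"
    by (rule subspace_dim_equal[OF linear_subspace_image[OF matrix_vector_mul_linear subspace_span] R])
       (unfold dimBW, rule order_refl)
  have "x \<bullet> (A *v y) = 0" for x
  proof -
    obtain w where w: "w \<in> ?W" "A *v x = B *v w" using RW by blast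
    have "B_inner B w y = 0"
      using w(1)
    proof (induction rule: span_induct)
      case base
      then show ?case by (auto simp: subspace_def B_inner_simps)
    next
      case (step x)
      then show ?case using y by auto
    qed
    then have "y \<bullet> (A *v x) = 0" using w(2) B_inner_commute[OF B, of y w] by (simp add: B_inner_def)
    then show ?thesis using skew_symmetric_inner[OF A, of x y] by simp
  qed
  then show ?thesis by (metis inner_eq_zero_iff)
qed

text \<open>
  In the coordinates with respect to all \<open>u\<^sub>k\<close> and \<open>v\<^sub>k\<close> the form is block diagonal with \<open>2 \<times> 2\<close> blocks
  \<open>\<sigma>\<^sub>k\<close> times a rotation by a right angle; what lies outside their span is annihilated by \<open>A\<close>. The bound
  is stated with the arithmetic mean of the two squared norms, since it is to be compared with a sum
  of squared sines.
\<close>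

lemma skew_form_le:
  fixes A B :: "real^'n^'n"
  assumes A: "skew_symmetric A" and B: "sym_pos_def B" and rank: "rank A = 2 * l"
    and trip: "gen_spectral_triplets A B l \<sigma> u v" and pos: "\<forall>k\<in>{1..l}. 0 < \<sigma> k"
    and le: "\<And>k. k \<in> {1..l} \<Longrightarrow> \<sigma> k \<le> C" and "0 \<le> C"
  shows "\<bar>x \<bullet> (A *v y)\<bar> \<le> C / 2 * (B_inner B x x + B_inner B y y)"
proof -
  let ?I = "{1..l} <+> {1..l}" and ?w = "case_sum u v"
  have on: "B_orthonormal B ?w ?I"
    and Auv: "\<And>k. k \<in> {1..l} \<Longrightarrow> A *v v k = \<sigma> k *\<^sub>R (B *v u k)"
      "\<And>k. k \<in> {1..l} \<Longrightarrow> A *v u k = - \<sigma> k *\<^sub>R (B *v v k)"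
    using trip by (auto simp: gen_spectral_triplets_def)
  have fin: "finite ?I" by simp
  define a b where "a x k = B_inner B (u k) x" and "b x k = B_inner B (v k) x" for x k
  define y' where "y' = (\<Sum>i\<in>?I. B_inner B (?w i) y *\<^sub>R ?w i)"
  have y': "y' = (\<Sum>k=1..l. a y k *\<^sub>R u k) + (\<Sum>k=1..l. b y k *\<^sub>R v k)"
    by (simp add: y'_def sum.Plus a_def b_def)
  have "A *v (y - y') = 0"
  proof (rule mult_eq_0_if_B_orthogonal_triplets[OF A B rank trip pos])
    fix k assume k: "k \<in> {1..l}"
    show "B_inner B (u k) (y - y') = 0"
      using B_orthonormal_residual[OF on fin InlI[OF k], of y] by (simp add: y'_def)
    show "B_inner B (v k) (y - y') = 0"
      using B_orthonormal_residual[OF on fin InrI[OF k], of y] by (simp add: y'_def)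
  qed
  then have "x \<bullet> (A *v y) = x \<bullet> (A *v y')" by (simp add: matrix_vector_mult_diff_distrib)
  also have "\<dots> = (\<Sum>k=1..l. a y k * (x \<bullet> (A *v u k))) + (\<Sum>k=1..l. b y k * (x \<bullet> (A *v v k)))"
    unfolding y' by (simp add: matrix_vector_right_distrib linear_sum[OF matrix_vector_mul_linear]
        matrix_vector_mult_scaleR inner_sum_right inner_right_distrib)
  also have "\<dots> = (\<Sum>k=1..l. \<sigma> k * (b y k * a x k - a y k * b x k))"
    unfolding sum.distrib[symmetric]
  proof (intro sum.cong refl)
    fix k assume k: "k \<in> {1..l}"
    have "x \<bullet> (A *v u k) = - \<sigma> k * b x k" "x \<bullet> (A *v v k) = \<sigma> k * a x k"
      using Auv[OF k] B_inner_commute[OF B, of x] by (simp_all add: a_def b_def B_inner_def)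
    then show "a y k * (x \<bullet> (A *v u k)) + b y k * (x \<bullet> (A *v v k))
        = \<sigma> k * (b y k * a x k - a y k * b x k)"
      by (simp add: algebra_simps)
  qed
  finally have "\<bar>x \<bullet> (A *v y)\<bar> \<le> (\<Sum>k=1..l. \<bar>\<sigma> k * (b y k * a x k - a y k * b x k)\<bar>)"
    by (simp only: sum_abs)
  also have "\<dots> \<le> (\<Sum>k=1..l. C / 2 * (((a x k)\<^sup>2 + (b x k)\<^sup>2) + ((a y k)\<^sup>2 + (b y k)\<^sup>2)))"
  proof (intro sum_mono)
    fix k assume k: "k \<in> {1..l}"
    have "\<bar>b y k * a x k - a y k * b x k\<bar>
        \<le> (((a x k)\<^sup>2 + (b x k)\<^sup>2) + ((a y k)\<^sup>2 + (b y k)\<^sup>2)) / 2"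
    proof (rule abs_leI)
      show "b y k * a x k - a y k * b x k
          \<le> (((a x k)\<^sup>2 + (b x k)\<^sup>2) + ((a y k)\<^sup>2 + (b y k)\<^sup>2)) / 2"
        using zero_le_power2[of "b y k - a x k"] zero_le_power2[of "a y k + b x k"]
        by (simp add: power2_eq_square algebra_simps)
      show "- (b y k * a x k - a y k * b x k)
          \<le> (((a x k)\<^sup>2 + (b x k)\<^sup>2) + ((a y k)\<^sup>2 + (b y k)\<^sup>2)) / 2"
        using zero_le_power2[of "b y k + a x k"] zero_le_power2[of "a y k - b x k"]
        by (simp add: power2_eq_square algebra_simps)
    qed
    then have "\<sigma> k * \<bar>b y k * a x k - a y k * b x k\<bar>
        \<le> C * ((((a x k)\<^sup>2 + (b x k)\<^sup>2) + ((a y k)\<^sup>2 + (b y k)\<^sup>2)) / 2)"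
      using le[OF k] \<open>0 \<le> C\<close> by (intro mult_mono) auto
    then show "\<bar>\<sigma> k * (b y k * a x k - a y k * b x k)\<bar>
        \<le> C / 2 * (((a x k)\<^sup>2 + (b x k)\<^sup>2) + ((a y k)\<^sup>2 + (b y k)\<^sup>2))"
      using pos[rule_format, OF k] by (simp add: abs_mult)
  qed
  also have "\<dots> = C / 2 * ((\<Sum>i\<in>?I. (B_inner B (?w i) x)\<^sup>2) + (\<Sum>i\<in>?I. (B_inner B (?w i) y)\<^sup>2))"
    unfolding sum_distrib_left[symmetric] by (simp add: sum.Plus sum.distrib a_def b_def)
  also have "\<dots> \<le> C / 2 * (B_inner B x x + B_inner B y y)"
    using \<open>0 \<le> C\<close> by (intro mult_left_mono add_mono B_orthonormal_bessel[OF B on fin]) auto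
  finally show ?thesis .
qed

section \<open>The sines of the canonical angles\<close>

lemma is_B_full_basis_exists:
  fixes B :: "real^'n^'n"
  assumes B: "sym_pos_def B" and w: "is_B_basis B W w"
  shows "\<exists>w'. is_B_full_basis B W w'"
proof -
  obtain w' where w': "\<forall>i\<in>{1..dim W}. w' i = w i" "B_orthonormal B w' {1..CARD('n)}"
    using B_orthonormal_extend[OF B dim_subset_UNIV_cart[of W] order_refl] w
    unfolding is_B_basis_def by blast
  moreover have "w' ` {1..dim W} = w ` {1..dim W}" using w'(1) by (intro image_cong) auto
  moreover have "B_orthonormal B w' {1..dim W}"
    using w w'(1) by (simp add: is_B_basis_def B_orthonormal_def)
  ultimately show ?thesis using w by (auto simp: is_B_full_basis_def is_B_basis_def)
qed

text \<open>
  The squared \<open>B\<close>-length of the component of \<open>x\<close> that is \<open>B\<close>-orthogonal to \<open>W\<close>, computed once from the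
  complementary block of a full basis and once from an arbitrary basis of \<open>W\<close>.
\<close>

lemma sum_complement_block:
  fixes B :: "real^'n^'n"
  assumes B: "sym_pos_def B" and full: "is_B_full_basis B W w'" and w: "is_B_basis B W w"
  shows "(\<Sum>i=1..CARD('n) - dim W. (B_inner B (w' (dim W + i)) x)\<^sup>2)
       = B_inner B x x - (\<Sum>i=1..dim W. (B_inner B (w i) x)\<^sup>2)"
proof -
  let ?d = "dim W" and ?n = "CARD('n)" and ?f = "\<lambda>i. (B_inner B (w' i) x)\<^sup>2"
  have d: "?d \<le> ?n" by (rule dim_subset_UNIV_cart)
  have on: "B_orthonormal B w' {1..?n}" and w': "is_B_basis B W w'"
    using full by (auto simp: is_B_full_basis_def)
  have "B_inner B x x = (\<Sum>i=1..?n. ?f i)"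
    using B_orthonormal_inner_expand[OF on, of x x] B_orthonormal_full_span[OF on]
    by (simp add: power2_eq_square)
  also have "\<dots> = (\<Sum>i=1..?d. ?f i) + (\<Sum>i=?d+1..?n. ?f i)"
    using sum.ub_add_nat[of 1 ?d ?f "?n - ?d"] d by simp
  also have "(\<Sum>i=?d+1..?n. ?f i) = (\<Sum>i=1..?n - ?d. ?f (?d + i))"
    using sum.shift_bounds_cl_nat_ivl[of ?f 1 ?d "?n - ?d"] d by (simp add: add.commute)
  also have "(\<Sum>i=1..?d. ?f i) = (\<Sum>i=1..?d. (B_inner B (w i) x)\<^sup>2)"
    using w w' by (intro B_orthonormal_sum_squares_cong[OF B]) (auto simp: is_B_basis_def)
  finally show ?thesis by simp
qed

lemma sin_B_angle_mat_witnesses: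
  fixes B :: "real^'n^'n"
  assumes B: "sym_pos_def B" and w: "is_B_basis B W w" and z: "is_B_basis B Z z"
  obtains w' z' where "is_B_full_basis B W w'" "is_B_basis B Z z'"
    "sin_B_angle_mat B W Z = (\<lambda>i j. B_inner B (w' (dim W + i)) (z' j))"
proof
  show "is_B_full_basis B W (SOME w. is_B_full_basis B W w)"
    using is_B_full_basis_exists[OF B w] by (rule someI_ex)
  show "is_B_basis B Z (SOME z. is_B_basis B Z z)"
    using z by (rule someI[where P = "is_B_basis B Z"])
  show "sin_B_angle_mat B W Z = (\<lambda>i j. B_inner B ((SOME w. is_B_full_basis B W w) (dim W + i))
      ((SOME z. is_B_basis B Z z) j))"
    by (simp add: sin_B_angle_mat_def Let_def)
qed

text \<open>
  The left-hand side is the squared distance of \<open>x\<close> from \<open>W\<close>, that is, the squared length of the image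
  of the coordinates of \<open>x\<close> under the matrix of sines. That matrix has norm at most 1, so that the
  supremum in the definition of its norm is a true upper bound.
\<close>

lemma sin_B_angle_2norm_bound:
  fixes B :: "real^'n^'n"
  assumes B: "sym_pos_def B" and w: "is_B_basis B W w" and z: "is_B_basis B Z z" and x: "x \<in> Z"
  shows "B_inner B x x - (\<Sum>i=1..dim W. (B_inner B (w i) x)\<^sup>2)
       \<le> (sin_B_angle_2norm B W Z)\<^sup>2 * B_inner B x x"
proof -
  obtain w' z' where w': "is_B_full_basis B W w'" and z': "is_B_basis B Z z'"
    and E: "sin_B_angle_mat B W Z = (\<lambda>i j. B_inner B (w' (dim W + i)) (z' j))"
    using sin_B_angle_mat_witnesses[OF B w z] .
  have on: "B_orthonormal B z' {1..dim Z}" and span: "span (z' ` {1..dim Z}) = Z"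
    using z' by (auto simp: is_B_basis_def)
  let ?E = "sin_B_angle_mat B W Z" and ?r = "CARD('n) - dim W" and ?c = "dim Z"
  define S where "S = {L2_set (nmat_vec ?c ?E y) {1..?r} | y. L2_set y {1..?c} \<le> 1}"
  have col: "(L2_set (nmat_vec ?c ?E y) {1..?r})\<^sup>2
      = B_inner B (cols_vec ?c z' y) (cols_vec ?c z' y)
        - (\<Sum>i=1..dim W. (B_inner B (w i) (cols_vec ?c z' y))\<^sup>2)" for y
  proof -
    have "nmat_vec ?c ?E y = (\<lambda>i. B_inner B (w' (dim W + i)) (cols_vec ?c z' y))"
      by (simp add: nmat_vec_def E cols_vec_def B_inner_sum_right mult.commute)
    moreover have "(L2_set f I)\<^sup>2 = (\<Sum>i\<in>I. (f i)\<^sup>2)" for f :: "nat \<Rightarrow> real" and I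
      by (simp add: L2_set_def sum_nonneg)
    ultimately show ?thesis
      by (simp only: sum_complement_block[OF B w' w])
  qed
  have bdd: "bdd_above S"
  proof (rule bdd_aboveI)
    fix a assume "a \<in> S"
    then obtain y where y: "a = L2_set (nmat_vec ?c ?E y) {1..?r}" "L2_set y {1..?c} \<le> 1"
      by (auto simp: S_def)
    have "a\<^sup>2 \<le> (L2_set y {1..?c})\<^sup>2"
      unfolding y col cols_vec_inner[OF on] by (simp add: sum_nonneg)
    also have "\<dots> \<le> 1\<^sup>2" using y by (intro power_mono) (auto simp: L2_set_nonneg)
    finally show "a \<le> 1" by (simp add: power2_le_imp_le)
  qed
  have unit: "B_inner B x x - (\<Sum>i=1..dim W. (B_inner B (w i) x)\<^sup>2) \<le> (sin_B_angle_2norm B W Z)\<^sup>2"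
    if "x \<in> Z" "B_inner B x x = 1" for x
  proof -
    define y where "y j = B_inner B (z' j) x" for j
    have xy: "x = cols_vec ?c z' y"
      unfolding cols_vec_def y_def using that span by (intro B_orthonormal_expand[OF on]) auto
    have "(L2_set y {1..?c})\<^sup>2 = 1"
      using cols_vec_inner[OF on, of y] that by (simp add: xy[symmetric])
    then have "(L2_set y {1..?c})\<^sup>2 \<le> 1\<^sup>2" by simp
    then have "L2_set y {1..?c} \<le> 1" by (rule power2_le_imp_le) simp
    then have "L2_set (nmat_vec ?c ?E y) {1..?r} \<in> S" by (auto simp: S_def)
    then have "L2_set (nmat_vec ?c ?E y) {1..?r} \<le> sin_B_angle_2norm B W Z"
      unfolding sin_B_angle_2norm_def nmat_2norm_def S_def[symmetric] using bdd by (rule cSup_upper)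
    then show ?thesis
      unfolding xy col[symmetric] by (intro power_mono) (auto simp: L2_set_nonneg)
  qed
  show ?thesis
  proof (cases "x = 0")
    case False
    let ?N = "B_inner B x x"
    have N: "0 < ?N" using False by (rule B_inner_pos[OF B])
    have "subspace Z" using span by (metis subspace_span)
    then have "x /\<^sub>R sqrt ?N \<in> Z" using x by (simp add: subspace_scale)
    moreover have scale: "B_inner B y (x /\<^sub>R sqrt ?N) = B_inner B y x / sqrt ?N" for y
      by (simp add: B_inner_simps divide_inverse mult.commute)
    have N1: "B_inner B (x /\<^sub>R sqrt ?N) (x /\<^sub>R sqrt ?N) = 1"
      using N by (simp add: B_inner_simps field_simps flip: power2_eq_square)
    ultimately have "1 - (\<Sum>i=1..dim W. (B_inner B (w i) x)\<^sup>2) / ?N \<le> (sin_B_angle_2norm B W Z)\<^sup>2"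
      using unit[of "x /\<^sub>R sqrt ?N"] N
      unfolding N1 scale by (simp add: power_divide sum_divide_distrib)
    then show ?thesis using N by (simp add: field_simps)
  qed (simp add: B_inner_simps)
qed

lemma sin_B_angle_Fnorm_power2:
  fixes B :: "real^'n^'n"
  assumes B: "sym_pos_def B" and w: "is_B_basis B W w" and z: "is_B_basis B Z z"
  shows "(sin_B_angle_Fnorm B W Z)\<^sup>2
       = (\<Sum>j=1..dim Z. B_inner B (z j) (z j) - (\<Sum>i=1..dim W. (B_inner B (w i) (z j))\<^sup>2))"
proof -
  obtain w' z' where w': "is_B_full_basis B W w'" and z': "is_B_basis B Z z'"
    and E: "sin_B_angle_mat B W Z = (\<lambda>i j. B_inner B (w' (dim W + i)) (z' j))"
    using sin_B_angle_mat_witnesses[OF B w z] .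
  have "(sin_B_angle_Fnorm B W Z)\<^sup>2
      = (\<Sum>i=1..CARD('n) - dim W. \<Sum>j=1..dim Z. (B_inner B (w' (dim W + i)) (z' j))\<^sup>2)"
    by (simp add: sin_B_angle_Fnorm_def nmat_Fnorm_def E sum_nonneg)
  also have "\<dots> = (\<Sum>i=1..CARD('n) - dim W. \<Sum>j=1..dim Z. (B_inner B (z j) (w' (dim W + i)))\<^sup>2)"
  proof (rule sum.cong[OF refl])
    fix i
    show "(\<Sum>j=1..dim Z. (B_inner B (w' (dim W + i)) (z' j))\<^sup>2)
        = (\<Sum>j=1..dim Z. (B_inner B (z j) (w' (dim W + i)))\<^sup>2)"
      unfolding B_inner_commute[OF B, of "w' _"]
      using z z' by (intro B_orthonormal_sum_squares_cong[OF B]) (auto simp: is_B_basis_def)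
  qed
  also have "\<dots> = (\<Sum>j=1..dim Z. \<Sum>i=1..CARD('n) - dim W. (B_inner B (w' (dim W + i)) (z j))\<^sup>2)"
    unfolding B_inner_commute[OF B, of "w' _"] by (rule sum.swap)
  finally show ?thesis by (simp only: sum_complement_block[OF B w' w])
qed

section \<open>The error of a Ritz value\<close>

text \<open>
  The hypothesis says \<open>K K\<^sup>T - C I\<close> is positive semidefinite for the \<open>2 \<times> 2\<close> matrix \<open>K\<close> with columns
  \<open>(a\<^sub>1, a\<^sub>2)\<close> and \<open>(b\<^sub>1, b\<^sub>2)\<close>. Since \<open>K\<^sup>T K\<close> has the same trace and determinant, \<open>K\<^sup>T K - C I\<close> is positive
  semidefinite too, which gives the bounds on the columns. For \<open>C \<ge> 0\<close>, both eigenvalues of \<open>K K\<^sup>T\<close> are at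
  least \<open>C\<close>, hence \<open>(det K)\<^sup>2 \<ge> C\<^sup>2\<close>.
\<close>

lemma two_by_two_singular_value_bound:
  fixes a1 a2 b1 b2 C :: real
  assumes psd: "\<And>y1 y2. C * (y1\<^sup>2 + y2\<^sup>2) \<le> (a1 * y1 + a2 * y2)\<^sup>2 + (b1 * y1 + b2 * y2)\<^sup>2"
  shows "C \<le> a1\<^sup>2 + a2\<^sup>2" and "C \<le> b1\<^sup>2 + b2\<^sup>2"
    and "0 \<le> a1 * b2 - a2 * b1 \<Longrightarrow> C \<le> a1 * b2 - a2 * b1"
proof -
  define P R q where "P = a1\<^sup>2 + b1\<^sup>2 - C" and "R = a2\<^sup>2 + b2\<^sup>2 - C" and "q = a1 * a2 + b1 * b2"
  have form: "0 \<le> P * y1\<^sup>2 + 2 * q * (y1 * y2) + R * y2\<^sup>2" for y1 y2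
    using psd[of y1 y2] by (simp add: P_def R_def q_def power2_eq_square algebra_simps)
  have "0 \<le> P" "0 \<le> R" using form[of 1 0] form[of 0 1] by auto
  have det: "q\<^sup>2 \<le> P * R"
  proof -
    consider "0 < P" | "0 < R" | "P = 0" "R = 0" using \<open>0 \<le> P\<close> \<open>0 \<le> R\<close> by linarith
    then show ?thesis
    proof cases
      case 1
      have "0 \<le> P * (P * R - q\<^sup>2)"
        using form[of "- q" P] by (simp add: power2_eq_square algebra_simps)
      then show ?thesis using 1 by (simp add: zero_le_mult_iff)
    next
      case 2
      have "0 \<le> R * (P * R - q\<^sup>2)"
        using form[of R "- q"] by (simp add: power2_eq_square algebra_simps)
      then show ?thesis using 2 by (simp add: zero_le_mult_iff)
    next
      case 3
      then show ?thesis using form[of 1 1] form[of 1 "- 1"] by simp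
    qed
  qed
  let ?S = "a1\<^sup>2 + a2\<^sup>2 - C" and ?T = "b1\<^sup>2 + b2\<^sup>2 - C"
  have "?S * ?T = P * R - q\<^sup>2 + (a1 * b1 + a2 * b2)\<^sup>2"
    by (simp add: P_def R_def q_def power2_eq_square algebra_simps)
  then have "0 \<le> ?S * ?T" using det by simp
  moreover have "0 \<le> ?S + ?T" using \<open>0 \<le> P\<close> \<open>0 \<le> R\<close> by (simp add: P_def R_def)
  ultimately have "0 \<le> ?S \<and> 0 \<le> ?T"
    unfolding zero_le_mult_iff by linarith
  then show "C \<le> a1\<^sup>2 + a2\<^sup>2" and "C \<le> b1\<^sup>2 + b2\<^sup>2" by auto
  show "C \<le> a1 * b2 - a2 * b1" if "0 \<le> a1 * b2 - a2 * b1"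
  proof (cases "C \<le> 0")
    case False
    have "(a1 * b2 - a2 * b1)\<^sup>2 - C\<^sup>2 = (P * R - q\<^sup>2) + C * P + C * R"
      by (simp add: P_def R_def q_def power2_eq_square algebra_simps)
    also have "\<dots> \<ge> 0" using det False \<open>0 \<le> P\<close> \<open>0 \<le> R\<close> by simp
    finally have "C\<^sup>2 \<le> (a1 * b2 - a2 * b1)\<^sup>2" by simp
    then show ?thesis using that by (rule power2_le_imp_le)
  qed (use that in linarith)
qed

lemma is_B_basis_pair:
  fixes x y :: "real^'n"
  assumes B: "sym_pos_def B" and "B_inner B x x = 1" "B_inner B y y = 1" "B_inner B x y = 0"
  defines "w \<equiv> \<lambda>i::nat. if i = 1 then x else y"
  shows "dim (span {x, y}) = 2" and "B_orthonormal B w {1..2}"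
    and "is_B_basis B (span {x, y}) w"
proof -
  have 12: "{1..2} = {1, 2::nat}" by auto
  show on: "B_orthonormal B w {1..2}"
    using assms B_inner_commute[OF B, of y x] unfolding 12 by (simp add: B_orthonormal_def)
  have im: "w ` {1..2} = {x, y}" unfolding 12 by (simp add: w_def insert_commute)
  show dim: "dim (span {x, y}) = 2" using B_orthonormal_dim_span[OF on] im by simp
  show "is_B_basis B (span {x, y}) w" unfolding is_B_basis_def dim im using on by simp
qed

text \<open>
  The plane of \<open>u\<close> and \<open>v\<close> and its \<open>B\<close>-orthogonal complement are both invariant under \<open>B\<^sup>-\<^sup>1 A\<close>, so the
  form \<open>x \<bullet> A y\<close> splits into \<open>\<sigma> det K\<close>, where \<open>K\<close> holds the coordinates of \<open>x\<close> and \<open>y\<close> in the plane, and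
  a remainder that is quadratic in the components outside the plane. The condition on the angles
  enters only through \<open>det K \<ge> 0\<close>: it excludes that the projections of \<open>x, y\<close> to the plane are oriented
  oppositely to \<open>u, v\<close>, in which case \<open>det K\<close> would be close to \<open>-1\<close> for small sines.
\<close>

lemma skew_form_error:
  fixes A B :: "real^'n^'n"
  assumes A: "skew_symmetric A" and B: "sym_pos_def B"
    and Auv: "A *v v = \<sigma> *\<^sub>R (B *v u)" "A *v u = - \<sigma> *\<^sub>R (B *v v)" and "0 \<le> \<sigma>"
    and uv: "B_inner B u u = 1" "B_inner B v v = 1" "B_inner B u v = 0"
    and xy: "B_inner B x x = 1" "B_inner B y y = 1" "B_inner B x y = 0"
    and bound: "\<And>x y. \<bar>x \<bullet> (A *v y)\<bar> \<le> C / 2 * (B_inner B x x + B_inner B y y)"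
    and angle: "sqrt 2 / 2 \<le> B_inner B x u" "sqrt 2 / 2 \<le> B_inner B y v"
  defines "S \<equiv> sin_B_angle_2norm B (span {x, y}) (span {u, v})"
    and "F \<equiv> sin_B_angle_Fnorm B (span {x, y}) (span {u, v})"
  shows "\<bar>x \<bullet> (A *v y) - \<sigma>\<bar> \<le> \<sigma> * S\<^sup>2 + C / 2 * F\<^sup>2" and "F\<^sup>2 \<le> 2 * S\<^sup>2"
proof -
  define z w where "z i = (if i = (1::nat) then u else v)" and "w i = (if i = (1::nat) then x else y)" for i
  note zs = is_B_basis_pair[OF B uv, folded z_def]
  note ws = is_B_basis_pair[OF B xy, folded w_def]
  have sum2: "(\<Sum>i=1..2. f i) = f 1 + f 2" for f :: "nat \<Rightarrow> 'b::comm_monoid_add"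
    by (simp add: numeral_2_eq_2)
  define a1 a2 b1 b2 where "a1 = B_inner B x u" and "a2 = B_inner B x v"
    and "b1 = B_inner B y u" and "b2 = B_inner B y v"
  note coords = a1_def a2_def b1_def b2_def
  define xr yr where "xr = x - (a1 *\<^sub>R u + a2 *\<^sub>R v)" and "yr = y - (b1 *\<^sub>R u + b2 *\<^sub>R v)"
  have xr: "B_inner B xr xr = 1 - (a1\<^sup>2 + a2\<^sup>2)" and yr: "B_inner B yr yr = 1 - (b1\<^sup>2 + b2\<^sup>2)"
    using B_orthonormal_pythagoras[OF B zs(2), of x] B_orthonormal_pythagoras[OF B zs(2), of y]
    unfolding sum2 by (simp_all add: z_def xr_def yr_def coords xy B_inner_commute[OF B, of u]
        B_inner_commute[OF B, of v])
  have ab1: "a1\<^sup>2 + a2\<^sup>2 \<le> 1" "b1\<^sup>2 + b2\<^sup>2 \<le> 1"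
    using xr yr B_inner_nonneg[OF B, of xr] B_inner_nonneg[OF B, of yr] by linarith+

  have "1 / 2 \<le> a1\<^sup>2" "1 / 2 \<le> b2\<^sup>2" and half: "1 / 2 \<le> a1 * b2"
  proof -
    have *: "1 / 2 \<le> s * t" if "sqrt 2 / 2 \<le> s" "sqrt 2 / 2 \<le> t" for s t :: real
    proof -
      have "sqrt 2 / 2 * (sqrt 2 / 2) \<le> s * t"
        using that order_trans[OF _ that(1), of 0] by (intro mult_mono) simp_all
      then show ?thesis by simp
    qed
    show "1 / 2 \<le> a1\<^sup>2" "1 / 2 \<le> b2\<^sup>2" "1 / 2 \<le> a1 * b2"
      using *[OF angle(1) angle(1)] *[OF angle(2) angle(2)] *[OF angle]
      by (simp_all add: power2_eq_square coords)
  qed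
  then have "a2\<^sup>2 + b1\<^sup>2 \<le> 1" using ab1 by linarith
  moreover have "2 * (a2 * b1) \<le> a2\<^sup>2 + b1\<^sup>2"
    using zero_le_power2[of "a2 - b1"] by (simp add: power2_eq_square algebra_simps)
  ultimately have det0: "0 \<le> a1 * b2 - a2 * b1" using half by linarith
  have det1: "a1 * b2 - a2 * b1 \<le> 1"
    using zero_le_power2[of "a1 - b2"] zero_le_power2[of "a2 + b1"] ab1
    by (simp add: power2_eq_square algebra_simps)

  have sin: "(1 - S\<^sup>2) * (s\<^sup>2 + t\<^sup>2) \<le> (a1 * s + a2 * t)\<^sup>2 + (b1 * s + b2 * t)\<^sup>2" for s t
  proof -
    let ?g = "s *\<^sub>R u + t *\<^sub>R v"
    have g: "?g \<in> span {u, v}" by (intro span_add span_scale span_base) auto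
    have "B_inner B ?g ?g = s\<^sup>2 + t\<^sup>2" "B_inner B x ?g = a1 * s + a2 * t"
      "B_inner B y ?g = b1 * s + b2 * t"
      using uv B_inner_commute[OF B, of v u]
      by (simp_all add: B_inner_simps coords power2_eq_square mult.commute)
    then show ?thesis
      using sin_B_angle_2norm_bound[OF B ws(3) zs(3) g]
      unfolding ws(1) sum2 S_def[symmetric] by (simp add: w_def algebra_simps)
  qed
  note K = two_by_two_singular_value_bound[OF sin]
  have F: "F\<^sup>2 = B_inner B xr xr + B_inner B yr yr"
    unfolding F_def sin_B_angle_Fnorm_power2[OF B ws(3) zs(3)] ws(1) zs(1) sum2 xr yr
    by (simp add: w_def z_def coords uv)
  show "F\<^sup>2 \<le> 2 * S\<^sup>2" using K(1,2) unfolding F xr yr by linarith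

  have orth: "B_inner B u yr = 0" "B_inner B v yr = 0"
    using uv B_inner_commute[OF B, of v u] B_inner_commute[OF B, of y]
    by (simp_all add: yr_def B_inner_simps coords)
  have "x \<bullet> (A *v y) = \<sigma> * (a1 * b2 - a2 * b1) + x \<bullet> (A *v yr)"
  proof -
    have "y = b1 *\<^sub>R u + b2 *\<^sub>R v + yr" by (simp add: yr_def)
    then have "A *v y = b1 *\<^sub>R (A *v u) + b2 *\<^sub>R (A *v v) + A *v yr"
      by (metis matrix_vector_right_distrib matrix_vector_mult_scaleR)
    then have "x \<bullet> (A *v y) = b1 * (x \<bullet> (A *v u)) + b2 * (x \<bullet> (A *v v)) + x \<bullet> (A *v yr)"
      by (simp add: inner_add_right)
    then show ?thesis by (simp add: Auv a1_def a2_def B_inner_def algebra_simps)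
  qed
  moreover have "x \<bullet> (A *v yr) = xr \<bullet> (A *v yr)"
  proof -
    have "u \<bullet> (A *v yr) = 0" "v \<bullet> (A *v yr) = 0"
      using skew_symmetric_inner[OF A, of _ yr] orth B_inner_commute[OF B, of yr]
      by (simp_all add: Auv B_inner_def)
    then show ?thesis by (simp add: xr_def inner_diff_left inner_add_left)
  qed
  ultimately have "\<bar>x \<bullet> (A *v y) - \<sigma>\<bar> = \<bar>xr \<bullet> (A *v yr) - \<sigma> * (1 - (a1 * b2 - a2 * b1))\<bar>"
    by (simp add: algebra_simps)
  also have "\<dots> \<le> \<bar>xr \<bullet> (A *v yr)\<bar> + \<sigma> * (1 - (a1 * b2 - a2 * b1))"
    using abs_triangle_ineq4[of "xr \<bullet> (A *v yr)" "\<sigma> * (1 - (a1 * b2 - a2 * b1))"] det1 \<open>0 \<le> \<sigma>\<close>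
    by (simp add: abs_mult)
  also have "\<dots> \<le> C / 2 * F\<^sup>2 + \<sigma> * S\<^sup>2"
    unfolding F using K(3)[OF det0] \<open>0 \<le> \<sigma>\<close> by (intro add_mono bound mult_left_mono) auto
  finally show "\<bar>x \<bullet> (A *v y) - \<sigma>\<bar> \<le> \<sigma> * S\<^sup>2 + C / 2 * F\<^sup>2" by simp
qed

theorem theorem3p4:
  fixes A B :: "real^'n^'n"
    and l m j j' :: nat
    and \<sigma> \<theta> \<alpha> \<beta> :: "nat \<Rightarrow> real"
    and u v p q s t u' v' :: "nat \<Rightarrow> real^'n"
    and c d :: "nat \<Rightarrow> nat \<Rightarrow> real"
    and X X' :: "(real^'n) set"
  assumes "skew_symmetric A"
    and "sym_pos_def B"
    and "nonzero_spectrum A B l \<sigma>"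
    and "\<forall>k\<in>{1..l}. simple_gen_eigenvalue A B (\<i> * complex_of_real (\<sigma> k)) \<and>
                     simple_gen_eigenvalue A B (- \<i> * complex_of_real (\<sigma> k))"
    and "strict_antimono_on {1..l} \<sigma>"
    and "\<forall>k\<in>{1..l}. 0 < \<sigma> k"
    and "gen_spectral_triplets A B l \<sigma> u v"
    and "m < l"
    and "B_norm B (q 1) = 1"
    and "gsslbd A B m p q s t \<alpha> \<beta>"
    and "no_breakdown m \<alpha> \<beta>"
    and "singular_triplets m (upper_bidiag \<alpha> \<beta>) \<theta> c d"
    and "\<forall>i\<in>{1..m}. u' i = cols_vec m p (c i) \<and> v' i = cols_vec m q (d i)"
    and "j \<in> {1..l}"
    and "j' \<in> {1..m}"
    and "\<forall>i\<in>{1..m}. \<bar>\<theta> j' - \<sigma> j\<bar> \<le> \<bar>\<theta> i - \<sigma> j\<bar>"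
    and "X' = span {u' j', v' j'}"
    and "X = span {u j, v j}"
    and "B_angle B (u' j') (u j) \<le> pi / 4"
    and "B_angle B (v' j') (v j) \<le> pi / 4"
  shows "\<bar>\<theta> j' - \<sigma> j\<bar> \<le> \<sigma> j * (sin_B_angle_2norm B X' X)\<^sup>2
                          + \<sigma> 1 / sqrt 2 * (sin_B_angle_Fnorm B X' X)\<^sup>2 \<and>
         \<bar>\<theta> j' - \<sigma> j\<bar> \<le> (\<sigma> 1 + \<sigma> j) * (sin_B_angle_2norm B X' X)\<^sup>2"
proof -
  note A = assms(1) and B = assms(2) and spec = assms(3) and anti = assms(5) and pos = assms(6)
    and trip = assms(7) and q1 = assms(9) and gs = assms(10) and nb = assms(11)
    and sv = assms(12) and j = assms(14) and j' = assms(15)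
  define x y where "x = u' j'" and "y = v' j'"
  have "x = cols_vec m p (c j')" "y = cols_vec m q (d j')"
    using assms(13) j' by (auto simp: x_def y_def)
  then have xy: "B_inner B x x = 1" "B_inner B y y = 1" "B_inner B x y = 0"
    and \<theta>: "x \<bullet> (A *v y) = \<theta> j'"
    using ritz_approximation[OF A B q1 gs nb sv j'] by simp_all
  have Auv: "A *v v j = \<sigma> j *\<^sub>R (B *v u j)" "A *v u j = - \<sigma> j *\<^sub>R (B *v v j)"
    and on: "B_orthonormal B (case_sum u v) ({1..l} <+> {1..l})"
    using trip j by (auto simp: gen_spectral_triplets_def)
  have uv: "B_inner B (u j) (u j) = 1" "B_inner B (v j) (v j) = 1" "B_inner B (u j) (v j) = 0"
    using B_orthonormal_sumD[OF on] j by (simp_all add: B_orthonormal_def)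
  have \<sigma>j: "0 \<le> \<sigma> j" using pos j by (simp add: less_imp_le)
  have "1 \<in> {1..l}" using j by auto
  then have \<sigma>1: "0 \<le> \<sigma> 1" using pos by (simp add: less_imp_le)
  have "\<sigma> k \<le> \<sigma> 1" if "k \<in> {1..l}" for k
    using monotone_onD[OF anti \<open>1 \<in> {1..l}\<close> that] that by (cases "k = 1") auto
  then have bound: "\<bar>x \<bullet> (A *v y)\<bar> \<le> \<sigma> 1 / 2 * (B_inner B x x + B_inner B y y)" for x y
    using spec \<sigma>1 by (intro skew_form_le[OF A B _ trip pos]) (auto simp: nonzero_spectrum_def)
  have angle: "sqrt 2 / 2 \<le> B_inner B x (u j)" "sqrt 2 / 2 \<le> B_inner B y (v j)"
    using B_angle_le_pi_quarter_imp[OF B xy(1) uv(1)] B_angle_le_pi_quarter_imp[OF B xy(2) uv(2)]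
      assms(19,20) unfolding x_def y_def by blast+
  let ?S = "sin_B_angle_2norm B X' X" and ?F = "sin_B_angle_Fnorm B X' X"
  note err = skew_form_error[OF A B Auv \<sigma>j uv xy bound angle, unfolded \<theta>,
      unfolded x_def y_def, folded assms(17,18)]
  have "\<sigma> 1 / 2 * ?F\<^sup>2 \<le> \<sigma> 1 / sqrt 2 * ?F\<^sup>2"
    using \<sigma>1 by (intro mult_right_mono divide_left_mono) (auto intro: real_le_lsqrt)
  moreover have "\<sigma> 1 / 2 * ?F\<^sup>2 \<le> \<sigma> 1 * ?S\<^sup>2"
    using mult_left_mono[OF err(2) \<sigma>1] by simp
  ultimately show ?thesis
    unfolding distrib_right using err(1) by (intro conjI; linarith)
qed

end
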